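(* Let $(X,d_X,\mu,T)$ and $(Y,d_Y,\nu,S)$ be compact metric measure-preserving systems. The following are equivalent: (1) $\mathcal J(T,S)/{\sim}=\{[\mu\otimes\nu]\}$, i.e. every $\lambda\in\mathcal J(T,S)$ satisfies $\lambda\sim\mu\otimes\nu$; (2) for every $n,m\ge1$, $\Phi_{n,m}(\mathcal J(T,S))=\{\Phi_{n,m}(\mu\otimes\nu)\}$.
   Context: A compact metric measure-preserving system $(X,d_X,\mu,T)$: $(X,d_X)$ compact metric, $\mu$ Borel probability, $T$ Borel with $T_\#\mu=\mu$; probability spaces standard and completed. $\mathcal J(T,S)$: Borel probability measures on $X\times Y$ with marginals $\mu,\nu$ invariant under $T\times S$. For $z_i=(x_i,y_i)$, $\mathcal D^X_{n,m}=(d_X(T^ax_i,T^bx_j))_{1\le i,j\le n,0\le a,b<m}$, $\mathcal D^Y_{n,m}=(d_Y(S^ay_i,S^by_j))_{1\le i,j\le n,0\le a,b<m}$, $\Phi_{n,m}(\lambda)=\mathrm{Law}_{\lambda^{\otimes n}}(\mathcal D^X_{n,m},\mathcal D^Y_{n,m})$. For $\lambda\in\mathcal J(T,S)$, $\mathcal K_\lambda$ is the marked colored kernel space on $(X\times Y,\lambda)$ with marks $M_X^{a,b}(x,y)=d_X(T^ax,T^bx)$, $M_Y^{a,b}(x,y)=d_Y(S^ay,S^by)$ and kernels $K_X^{a,b}((x,y),(x',y'))=d_X(T^ax,T^bx')$, $K_Y^{a,b}((x,y),(x',y'))=d_Y(S^ay,S^by')$, $a,b\ge0$. In a marked colored kernel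 space, points $z,z'$ are twins if all marks agree and for each kernel $k$, $k(z,w)=k(z',w)$ and $k(w,z)=k(w,z')$ for a.e. $w$; the twin-free quotient $\mathcal K^{\rm tw}$ is the space obtained (modulo null sets) by identifying twins, with pushforward measure and descended marks and kernels. Two marked colored kernel spaces are kernel-isomorphic if a measure-space isomorphism $U$ preserves every mark a.e. and every kernel a.e. on the product. Define $\lambda\sim\lambda'$ iff $\mathcal K_\lambda^{\rm tw}$ and $\mathcal K_{\lambda'}^{\rm tw}$ are kernel-isomorphic; $[\mu\otimes\nu]$ is the class of the product joining. *)

theory Defs
  imports "HOL-Probability.Probability"
begin

definition cmmps :: "'a::metric_space set \<Rightarrow> 'a measure \<Rightarrow> ('a \<Rightarrow> 'a) \<Rightarrow> bool" where
  "cmmps X \<mu> T \<longleftrightarrow> compact X \<and> prob_space \<mu> \<and> space \<mu> = X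
     \<and> sets \<mu> = sets (restrict_space borel X)
     \<and> T \<in> \<mu> \<rightarrow>\<^sub>M \<mu> \<and> distr \<mu> \<mu> T = \<mu>"

definition joinings ::
  "'a::metric_space set \<Rightarrow> 'a measure \<Rightarrow> ('a \<Rightarrow> 'a) \<Rightarrow>
   'b::metric_space set \<Rightarrow> 'b measure \<Rightarrow> ('b \<Rightarrow> 'b) \<Rightarrow> ('a \<times> 'b) measure set" where
  "joinings X \<mu> T Y \<nu> S = {L. prob_space L \<and> space L = X \<times> Y
     \<and> sets L = sets (restrict_space borel (X \<times> Y))
     \<and> distr L \<mu> fst = \<mu> \<and> distr L \<nu> snd = \<nu>
     \<and> (\<lambda>(x, y). (T x, S y)) \<in> L \<rightarrow>\<^sub>M L
     \<and> distr L L (\<lambda>(x, y). (T x, S y)) = L}"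

text \<open>Index set of an (n,m) distance matrix: rows and columns are pairs (i,a) with
  i < n (sample index, 0-based) and a < m (time index).\<close>
definition mat_idx :: "nat \<Rightarrow> nat \<Rightarrow> ((nat \<times> nat) \<times> (nat \<times> nat)) set" where
  "mat_idx n m = ({..<n} \<times> {..<m}) \<times> ({..<n} \<times> {..<m})"

definition mat_space :: "nat \<Rightarrow> nat \<Rightarrow> ((nat \<times> nat) \<times> (nat \<times> nat) \<Rightarrow> real) measure" where
  "mat_space n m = PiM (mat_idx n m) (\<lambda>_. borel)"

definition DX :: "('a::metric_space \<Rightarrow> 'a) \<Rightarrow> nat \<Rightarrow> nat \<Rightarrow> (nat \<Rightarrow> 'a \<times> 'b)
    \<Rightarrow> (nat \<times> nat) \<times> (nat \<times> nat) \<Rightarrow> real" where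
  "DX T n m z = restrict (\<lambda>((i, a), (j, b)). dist ((T ^^ a) (fst (z i))) ((T ^^ b) (fst (z j))))
                         (mat_idx n m)"

definition DY :: "('b::metric_space \<Rightarrow> 'b) \<Rightarrow> nat \<Rightarrow> nat \<Rightarrow> (nat \<Rightarrow> 'a \<times> 'b)
    \<Rightarrow> (nat \<times> nat) \<times> (nat \<times> nat) \<Rightarrow> real" where
  "DY S n m z = restrict (\<lambda>((i, a), (j, b)). dist ((S ^^ a) (snd (z i))) ((S ^^ b) (snd (z j))))
                         (mat_idx n m)"

definition Phi :: "('a::metric_space \<Rightarrow> 'a) \<Rightarrow> ('b::metric_space \<Rightarrow> 'b) \<Rightarrow> nat \<Rightarrow> nat
    \<Rightarrow> ('a \<times> 'b) measure
    \<Rightarrow> (((nat \<times> nat) \<times> (nat \<times> nat) \<Rightarrow> real) \<times> ((nat \<times> nat) \<times> (nat \<times> nat) \<Rightarrow> real)) measure" where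
  "Phi T S n m L = distr (PiM {..<n} (\<lambda>_. L)) (mat_space n m \<Otimes>\<^sub>M mat_space n m)
                        (\<lambda>z. (DX T n m z, DY S n m z))"

text \<open>A marked colored kernel space is given by a probability space P, a family of marks
  Mk c : Z -> real and a family of kernels K k : Z -> Z -> real.\<close>

definition twins :: "'z measure \<Rightarrow> ('c \<Rightarrow> 'z \<Rightarrow> real) \<Rightarrow> ('k \<Rightarrow> 'z \<Rightarrow> 'z \<Rightarrow> real)
    \<Rightarrow> 'z \<Rightarrow> 'z \<Rightarrow> bool" where
  "twins P Mk K z z' \<longleftrightarrow> (\<forall>c. Mk c z = Mk c z')
     \<and> (\<forall>k. (AE w in P. K k z w = K k z' w) \<and> (AE w in P. K k w z = K k w z'))"

definition twin_class :: "'z measure \<Rightarrow> ('c \<Rightarrow> 'z \<Rightarrow> real) \<Rightarrow> ('k \<Rightarrow> 'z \<Rightarrow> 'z \<Rightarrow> real)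
    \<Rightarrow> 'z \<Rightarrow> 'z set" where
  "twin_class P Mk K z = {z' \<in> space P. twins P Mk K z z'}"

definition tw_space :: "'z measure \<Rightarrow> ('c \<Rightarrow> 'z \<Rightarrow> real) \<Rightarrow> ('k \<Rightarrow> 'z \<Rightarrow> 'z \<Rightarrow> real)
    \<Rightarrow> 'z set measure" where
  "tw_space P Mk K = distr P
     (measure_of (twin_class P Mk K ` space P)
        {A. A \<subseteq> twin_class P Mk K ` space P \<and> twin_class P Mk K -` A \<inter> space P \<in> sets P}
        (\<lambda>_. 0))
     (twin_class P Mk K)"

text \<open>Descended marks (well defined, since twins have identical marks).\<close>
definition tw_mark :: "'z measure \<Rightarrow> ('c \<Rightarrow> 'z \<Rightarrow> real) \<Rightarrow> ('k \<Rightarrow> 'z \<Rightarrow> 'z \<Rightarrow> real)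
    \<Rightarrow> 'c \<Rightarrow> 'z set \<Rightarrow> real" where
  "tw_mark P Mk K c C = Mk c (SOME z. z \<in> C)"

text \<open>A descended kernel (defined modulo null sets): a measurable kernel on the quotient
  which agrees almost everywhere with the original kernel through the quotient map.\<close>
definition descended_kernel :: "'z measure \<Rightarrow> ('c \<Rightarrow> 'z \<Rightarrow> real) \<Rightarrow> ('k \<Rightarrow> 'z \<Rightarrow> 'z \<Rightarrow> real)
    \<Rightarrow> 'k \<Rightarrow> ('z set \<Rightarrow> 'z set \<Rightarrow> real) \<Rightarrow> bool" where
  "descended_kernel P Mk K k K' \<longleftrightarrow>
     (\<lambda>(C, D). K' C D) \<in> borel_measurable (tw_space P Mk K \<Otimes>\<^sub>M tw_space P Mk K)
     \<and> (AE p in P \<Otimes>\<^sub>M P. K' (twin_class P Mk K (fst p)) (twin_class P Mk K (snd p))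
                          = K k (fst p) (snd p))"

definition kernel_iso :: "'p measure \<Rightarrow> ('c \<Rightarrow> 'p \<Rightarrow> real) \<Rightarrow> ('k \<Rightarrow> 'p \<Rightarrow> 'p \<Rightarrow> real)
    \<Rightarrow> 'q measure \<Rightarrow> ('c \<Rightarrow> 'q \<Rightarrow> real) \<Rightarrow> ('k \<Rightarrow> 'q \<Rightarrow> 'q \<Rightarrow> real) \<Rightarrow> bool" where
  "kernel_iso P1 M1 K1 P2 M2 K2 \<longleftrightarrow> (\<exists>U V. U \<in> P1 \<rightarrow>\<^sub>M P2 \<and> V \<in> P2 \<rightarrow>\<^sub>M P1
     \<and> distr P1 P2 U = P2
     \<and> (AE x in P1. V (U x) = x) \<and> (AE y in P2. U (V y) = y)
     \<and> (\<forall>c. AE x in P1. M2 c (U x) = M1 c x)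
     \<and> (\<forall>k. AE p in P1 \<Otimes>\<^sub>M P1. K2 k (U (fst p)) (U (snd p)) = K1 k (fst p) (snd p)))"

definition tw_kernel_iso :: "'z measure \<Rightarrow> ('c \<Rightarrow> 'z \<Rightarrow> real) \<Rightarrow> ('k \<Rightarrow> 'z \<Rightarrow> 'z \<Rightarrow> real)
    \<Rightarrow> 'w measure \<Rightarrow> ('c \<Rightarrow> 'w \<Rightarrow> real) \<Rightarrow> ('k \<Rightarrow> 'w \<Rightarrow> 'w \<Rightarrow> real) \<Rightarrow> bool" where
  "tw_kernel_iso P1 M1 K1 P2 M2 K2 \<longleftrightarrow> (\<exists>K1' K2'.
      (\<forall>k. descended_kernel P1 M1 K1 k (K1' k)) \<and> (\<forall>k. descended_kernel P2 M2 K2 k (K2' k))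
      \<and> kernel_iso (tw_space P1 M1 K1) (tw_mark P1 M1 K1) K1'
                   (tw_space P2 M2 K2) (tw_mark P2 M2 K2) K2')"

definition jmark :: "('a::metric_space \<Rightarrow> 'a) \<Rightarrow> ('b::metric_space \<Rightarrow> 'b)
    \<Rightarrow> bool \<times> nat \<times> nat \<Rightarrow> 'a \<times> 'b \<Rightarrow> real" where
  "jmark T S = (\<lambda>(s, a, b) (x, y). if s then dist ((T ^^ a) x) ((T ^^ b) x)
                                   else dist ((S ^^ a) y) ((S ^^ b) y))"

definition jkernel :: "('a::metric_space \<Rightarrow> 'a) \<Rightarrow> ('b::metric_space \<Rightarrow> 'b)
    \<Rightarrow> bool \<times> nat \<times> nat \<Rightarrow> 'a \<times> 'b \<Rightarrow> 'a \<times> 'b \<Rightarrow> real" where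
  "jkernel T S = (\<lambda>(s, a, b) (x, y) (x', y'). if s then dist ((T ^^ a) x) ((T ^^ b) x')
                                              else dist ((S ^^ a) y) ((S ^^ b) y'))"

definition joining_equiv :: "('a::metric_space \<Rightarrow> 'a) \<Rightarrow> ('b::metric_space \<Rightarrow> 'b)
    \<Rightarrow> ('a \<times> 'b) measure \<Rightarrow> ('a \<times> 'b) measure \<Rightarrow> bool" where
  "joining_equiv T S L L' \<longleftrightarrow>
     tw_kernel_iso (completion L) (jmark T S) (jkernel T S)
                   (completion L') (jmark T S) (jkernel T S)"

end

theory Submission
  imports Defs
begin

text \<open>
  Both conditions say that the product is the only joining.

  A kernel isomorphism between twin-free quotients transports marks and kernels, hence the law of
  every matrix built from an i.i.d. sample, which gives (1) implies (2).

  For (2) implies (1), only the times \<open>m = 1\<close> are needed. Let \<open>w\<close> be an i.i.d. sample of a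
  joining, \<open>A\<close> and \<open>B\<close> finite intersections of balls centred at the sampled points of \<open>X\<close> and \<open>Y\<close>,
  and \<open>a, b, c\<close> the probabilities of \<open>A \<times> B\<close>, \<open>A \<times> Y\<close>, \<open>X \<times> B\<close>. With four further sample
  points, the means of \<open>a\<^sup>2\<close>, \<open>a b c\<close>, \<open>b\<^sup>2 c\<^sup>2\<close> over \<open>w\<close> are probabilities of events in
  the distance matrices. So they are the same as for the product, where they coincide,
  and \<open>(a - b c)\<^sup>2\<close> has mean zero. As an infinite sample is almost surely dense in the supports,
  the sets \<open>A\<close> and \<open>B\<close> generate both Borel algebras up to null sets, and the joining is the product.
  It remains to see that the product is equivalent to itself, which amounts to the existence of the
  descended kernels.
\<close>

section \<open>Compact metric probability spaces\<close>

lemma open_Int_restrict_borel: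
  assumes "open U"
  shows "U \<inter> X \<in> sets (restrict_space borel X)"
  unfolding sets_restrict_space by (rule image_eqI[of _ _ U]) (simp_all add: assms Int_commute)

text \<open>Finite covers of \<open>X\<close> by balls of radius \<open>1 / Suc n\<close>, taken
  over all \<open>n\<close>, form the family: a ball of radius below \<open>e / 2\<close> that
  contains \<open>x\<close> lies in the ball of radius \<open>e\<close> around \<open>x\<close>. On
  \<open>X\<close> this replaces a countable base of the ambient type, which is an arbitrary metric
  space.\<close>

lemma compact_countable_base:
  fixes X :: "'a::metric_space set"
  assumes "compact X"
  obtains \<B> where "countable \<B>" "\<And>B. B \<in> \<B> \<Longrightarrow> open B"
    "\<And>U x. open U \<Longrightarrow> x \<in> U \<Longrightarrow> x \<in> X \<Longrightarrow> \<exists>B\<in>\<B>. x \<in> B \<and> B \<inter> X \<subseteq> U"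
proof -
  have "\<exists>k. finite k \<and> k \<subseteq> X \<and> X \<subseteq> (\<Union>x\<in>k. ball x (1 / real (Suc n)))" for n
  proof -
    have "X \<subseteq> (\<Union>x\<in>X. ball x (1 / real (Suc n)))" by auto
    from compactE_image[OF assms _ this] show ?thesis by (metis open_ball)
  qed
  then obtain k where k: "\<And>n. finite (k n)" "\<And>n. k n \<subseteq> X"
    "\<And>n. X \<subseteq> (\<Union>x\<in>k n. ball x (1 / real (Suc n)))" by metis
  define \<B> where "\<B> = (\<Union>n. (\<lambda>x. ball x (1 / real (Suc n))) ` k n)"
  have "\<exists>B\<in>\<B>. x \<in> B \<and> B \<inter> X \<subseteq> U" if U: "open U" "x \<in> U" "x \<in> X" for U x
  proof -
    obtain e where e: "e > 0" "ball x e \<subseteq> U" using U open_contains_ball by blast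
    obtain n where n: "1 / real (Suc n) < e / 2"
      using e(1) nat_approx_posE[of "e / 2"] by auto
    obtain p where p: "p \<in> k n" "x \<in> ball p (1 / real (Suc n))" using k(3) U(3) by blast
    have "ball p (1 / real (Suc n)) \<subseteq> ball x e"
    proof
      fix y assume "y \<in> ball p (1 / real (Suc n))"
      then show "y \<in> ball x e"
        using p(2) n dist_triangle[of x y p] by (simp add: dist_commute)
    qed
    then show ?thesis using p e(2) unfolding \<B>_def by blast
  qed
  moreover have "countable \<B>" unfolding \<B>_def
    by (intro countable_UN countable_image) (auto simp: k countable_finite)
  moreover have "\<And>B. B \<in> \<B> \<Longrightarrow> open B" unfolding \<B>_def by auto
  ultimately show thesis using that by blast
qed

text \<open>No second countability of the ambient types is assumed, so the Borel sets of
  \<open>'a \<times> 'b\<close> need not be generated by rectangles; on compact sets they are.\<close>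
lemma sets_restrict_borel_Times:
  fixes X :: "'a::metric_space set" and Y :: "'b::metric_space set"
  assumes X: "compact X" and Y: "compact Y"
  shows "sets (restrict_space borel (X \<times> Y)) =
    sets (restrict_space borel X \<Otimes>\<^sub>M restrict_space borel Y)" (is "sets ?L = sets ?R")
proof
  have spL: "space ?L = X \<times> Y" and spR: "space ?R = X \<times> Y"
    by (simp_all add: space_restrict_space space_pair_measure)
  have f: "fst \<in> ?L \<rightarrow>\<^sub>M restrict_space borel X"
    by (intro measurable_restrict_space3 borel_measurable_continuous_onI continuous_intros) auto
  have s: "snd \<in> ?L \<rightarrow>\<^sub>M restrict_space borel Y"
    by (intro measurable_restrict_space3 borel_measurable_continuous_onI continuous_intros) auto
  have "(\<lambda>z. (fst z, snd z)) \<in> ?L \<rightarrow>\<^sub>M ?R" using f s by measurable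
  then have id: "(\<lambda>z. z) \<in> ?L \<rightarrow>\<^sub>M ?R" by simp
  show "sets ?R \<subseteq> sets ?L"
  proof
    fix A assume A: "A \<in> sets ?R"
    have "(\<lambda>z. z) -` A \<inter> space ?L \<in> sets ?L" by (rule measurable_sets[OF id A])
    moreover have "A \<subseteq> X \<times> Y" using sets.sets_into_space[OF A] spR by simp
    ultimately show "A \<in> sets ?L" by (simp add: spL Int_absorb2)
  qed
  obtain \<A> where \<A>: "countable \<A>" "\<And>B. B \<in> \<A> \<Longrightarrow> open B"
    "\<And>U x. open U \<Longrightarrow> x \<in> U \<Longrightarrow> x \<in> X \<Longrightarrow> \<exists>B\<in>\<A>. x \<in> B \<and> B \<inter> X \<subseteq> U"
    using compact_countable_base[OF X] by metis
  obtain \<B> where \<B>: "countable \<B>" "\<And>B. B \<in> \<B> \<Longrightarrow> open B"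
    "\<And>U x. open U \<Longrightarrow> x \<in> U \<Longrightarrow> x \<in> Y \<Longrightarrow> \<exists>B\<in>\<B>. x \<in> B \<and> B \<inter> Y \<subseteq> U"
    using compact_countable_base[OF Y] by metis
  \<comment> \<open>Within \<open>X \<times> Y\<close>, an open set is the union of the basic
    rectangles it contains, and countability of both bases makes this a countable union.\<close>
  have op: "(X \<times> Y) \<inter> U \<in> sets ?R" if U: "open U" for U
  proof -
    let ?P = "{p \<in> \<A> \<times> \<B>. (fst p \<inter> X) \<times> (snd p \<inter> Y) \<subseteq> U}"
    have "(X \<times> Y) \<inter> U = (\<Union>p\<in>?P. (fst p \<inter> X) \<times> (snd p \<inter> Y))"
    proof (intro equalityI subsetI)
      fix z assume z: "z \<in> (X \<times> Y) \<inter> U"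
      obtain A B where AB: "open A" "open B" "z \<in> A \<times> B" "A \<times> B \<subseteq> U"
        using U z by (metis IntD2 open_prod_elim)
      obtain A' where "A' \<in> \<A>" "fst z \<in> A'" "A' \<inter> X \<subseteq> A" using \<A>(3)[of A "fst z"] AB z by auto
      moreover obtain B' where "B' \<in> \<B>" "snd z \<in> B'" "B' \<inter> Y \<subseteq> B"
        using \<B>(3)[of B "snd z"] AB z by auto
      ultimately have "(A', B') \<in> ?P" "z \<in> (A' \<inter> X) \<times> (B' \<inter> Y)" using AB(4) z by (auto simp: mem_Times_iff)
      then show "z \<in> (\<Union>p\<in>?P. (fst p \<inter> X) \<times> (snd p \<inter> Y))" by force
    qed auto
    moreover have "(\<Union>p\<in>?P. (fst p \<inter> X) \<times> (snd p \<inter> Y)) \<in> sets ?R"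
    proof (rule sets.countable_UN'')
      show "countable ?P" by (rule countable_subset[of _ "\<A> \<times> \<B>"]) (auto simp: \<A> \<B>)
      fix p assume "p \<in> ?P"
      then have "open (fst p)" "open (snd p)" using \<A>(2) \<B>(2) by auto
      then show "(fst p \<inter> X) \<times> (snd p \<inter> Y) \<in> sets ?R"
        by (intro pair_measureI open_Int_restrict_borel)
    qed
    ultimately show ?thesis by simp
  qed
  have "(\<lambda>z. z) \<in> ?R \<rightarrow>\<^sub>M borel"
    by (rule borel_measurableI) (use op in \<open>simp add: spR Int_commute\<close>)
  then have id': "(\<lambda>z. z) \<in> ?R \<rightarrow>\<^sub>M ?L" by (intro measurable_restrict_space2) (auto simp: spR)
  show "sets ?L \<subseteq> sets ?R"
  proof
    fix A assume A: "A \<in> sets ?L"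
    have "(\<lambda>z. z) -` A \<inter> space ?R \<in> sets ?R" by (rule measurable_sets[OF id' A])
    moreover have "A \<subseteq> X \<times> Y" using sets.sets_into_space[OF A] spL by simp
    ultimately show "A \<in> sets ?R" by (simp add: spR Int_absorb2)
  qed
qed

locale compact_metric_prob = prob_space \<mu> for \<mu> :: "'a::metric_space measure" +
  fixes X :: "'a set"
  assumes compact_X: "compact X"
    and space_eq: "space \<mu> = X"
    and sets_eq[measurable_cong]: "sets \<mu> = sets (restrict_space borel X)"
begin

lemma open_Int_sets: "open U \<Longrightarrow> U \<inter> X \<in> sets \<mu>"
  by (simp add: sets_eq open_Int_restrict_borel)

text \<open>The metric is continuous, hence Borel on \<open>X \<times> X\<close>; by compactness the
  Borel sets there are those of the product sigma-algebra.\<close>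

lemma dist_measurable: "(\<lambda>p. dist (fst p) (snd p)) \<in> borel_measurable (\<mu> \<Otimes>\<^sub>M \<mu>)"
proof -
  have "sets (restrict_space borel (X \<times> X)) = sets (\<mu> \<Otimes>\<^sub>M \<mu>)"
    unfolding sets_restrict_borel_Times[OF compact_X compact_X]
    by (intro sets_pair_measure_cong) (simp_all add: sets_eq)
  moreover have "(\<lambda>p. dist (fst p) (snd p)) \<in> borel_measurable (restrict_space borel (X \<times> X))"
    by (intro measurable_restrict_space1 borel_measurable_continuous_onI continuous_intros)
  ultimately show ?thesis using measurable_cong_sets by blast
qed

lemma measurable_dist[measurable (raw)]:
  assumes "f \<in> N \<rightarrow>\<^sub>M \<mu>" "g \<in> N \<rightarrow>\<^sub>M \<mu>"
  shows "(\<lambda>z. dist (f z) (g z)) \<in> borel_measurable N"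
  using measurable_compose[OF measurable_Pair[OF assms] dist_measurable] by simp

definition support :: "'a set" where
  "support = {x \<in> X. \<forall>U. open U \<longrightarrow> x \<in> U \<longrightarrow> prob (U \<inter> X) > 0}"

lemma support_subset: "support \<subseteq> X"
  by (auto simp: support_def)

text \<open>The complement of the support in \<open>X\<close> is the union of the basic sets of
  measure zero, and there are only countably many of them.\<close>

lemma support_sets: "support \<in> sets \<mu>"
  and AE_support: "AE x in \<mu>. x \<in> support"
proof -
  obtain \<B> where \<B>: "countable \<B>" "\<And>B. B \<in> \<B> \<Longrightarrow> open B"
    "\<And>U x. open U \<Longrightarrow> x \<in> U \<Longrightarrow> x \<in> X \<Longrightarrow> \<exists>B\<in>\<B>. x \<in> B \<and> B \<inter> X \<subseteq> U"
    using compact_countable_base[OF compact_X] by metis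
  define N where "N = (\<Union>B\<in>{B\<in>\<B>. prob (B \<inter> X) = 0}. B \<inter> X)"
  have N: "N \<in> null_sets \<mu>" unfolding N_def
  proof (rule null_sets_UN')
    show "countable {B \<in> \<B>. prob (B \<inter> X) = 0}" using \<B>(1) by auto
    show "B \<inter> X \<in> null_sets \<mu>" if "B \<in> {B \<in> \<B>. prob (B \<inter> X) = 0}" for B
      using that \<B>(2) by (auto intro!: null_setsI open_Int_sets simp: emeasure_eq_measure)
  qed
  have "prob (U \<inter> X) > 0" if U: "open U" "x \<in> U" "x \<in> X - N" for U x
  proof -
    from U obtain B where B: "B \<in> \<B>" "x \<in> B" "B \<inter> X \<subseteq> U" using \<B>(3)[of U x] by auto
    then have "prob (B \<inter> X) \<noteq> 0" using U(3) unfolding N_def by auto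
    moreover have "prob (B \<inter> X) \<le> prob (U \<inter> X)"
      by (rule finite_measure_mono) (use B U in \<open>auto intro: open_Int_sets\<close>)
    ultimately show "prob (U \<inter> X) > 0" using measure_nonneg[of \<mu> "B \<inter> X"] by linarith
  qed
  moreover have "x \<notin> N" if "x \<in> support" for x
    using that \<B>(2) unfolding N_def support_def by force
  ultimately have eq: "support = X - N" using support_subset by (auto simp: support_def)
  show "support \<in> sets \<mu>" using N unfolding eq by (metis sets.compl_sets null_setsD2 space_eq)
  show "AE x in \<mu>. x \<in> support"
    using AE_not_in[OF N] AE_space unfolding eq by eventually_elim (simp add: space_eq)
qed

end

section \<open>Sampling\<close>

text \<open>Fubini in conditional form: given the first \<open>k\<close> coordinates
  \<open>w\<close>, the other \<open>l\<close> are independent, so the integral of a product of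
  functions of \<open>w\<close> and one further coordinate each is the product of the integrals. The
  induction integrates out the last coordinate and absorbs the result, a function of
  \<open>w\<close> alone, into the weight \<open>h\<close>, which must therefore stay
  arbitrary.\<close>

lemma (in prob_space) nn_integral_PiM_split:
  fixes f :: "nat \<Rightarrow> (nat \<Rightarrow> 'a) \<Rightarrow> 'a \<Rightarrow> ennreal"
  assumes f: "\<And>j. (\<lambda>p. f j (fst p) (snd p)) \<in> borel_measurable (PiM {..<k} (\<lambda>_. M) \<Otimes>\<^sub>M M)"
    and h: "h \<in> borel_measurable (PiM {..<k} (\<lambda>_. M))"
  shows "(\<integral>\<^sup>+v. h (restrict v {..<k}) * (\<Prod>j<l. f j (restrict v {..<k}) (v (k + j)))
      \<partial>PiM {..<k + l} (\<lambda>_. M))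
    = (\<integral>\<^sup>+w. h w * (\<Prod>j<l. \<integral>\<^sup>+z. f j w z \<partial>M) \<partial>PiM {..<k} (\<lambda>_. M))"
  using h
proof (induction l arbitrary: h)
  case 0
  have "(\<integral>\<^sup>+v. h (restrict v {..<k}) \<partial>PiM {..<k} (\<lambda>_. M)) = (\<integral>\<^sup>+w. h w \<partial>PiM {..<k} (\<lambda>_. M))"
  proof (rule nn_integral_cong)
    fix w assume "w \<in> space (PiM {..<k} (\<lambda>_. M))"
    then have "restrict w {..<k} = w" unfolding space_PiM by (rule PiE_restrict)
    then show "h (restrict w {..<k}) = h w" by (rule arg_cong)
  qed
  then show ?case by (simp only: add_0_right lessThan_0 prod.empty mult_1_right)
next
  case (Suc l)
  note h[measurable] = Suc.prems
  interpret product_sigma_finite "\<lambda>_::nat. M"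
    by (intro product_sigma_finite.intro) (rule sigma_finite_measure_axioms)
  let ?P = "\<lambda>n. PiM {..<n} (\<lambda>_. M)"
  have R[measurable]: "(\<lambda>v. restrict v {..<k}) \<in> ?P (k + m) \<rightarrow>\<^sub>M ?P k" for m
    by (intro measurable_restrict_subset) auto
  have c[measurable]: "(\<lambda>v. v (k + j)) \<in> ?P (k + m) \<rightarrow>\<^sub>M M" if "j < m" for j m
    by (rule measurable_component_singleton) (use that in auto)
  have fm: "(\<lambda>v. f j (restrict v {..<k}) (v (k + j))) \<in> borel_measurable (?P (k + m))" if "j < m" for j m
    using measurable_compose[OF measurable_Pair[OF R c[OF that]] f[of j]] by simp
  have Fm[measurable]: "(\<lambda>w. \<integral>\<^sup>+z. f l w z \<partial>M) \<in> borel_measurable (?P k)"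
    by (rule borel_measurable_nn_integral) (use f[of l] in \<open>simp add: case_prod_beta'\<close>)
  have fl: "(\<lambda>z. f l w z) \<in> borel_measurable M" if "w \<in> space (?P k)" for w
    using measurable_compose[OF measurable_Pair1'[OF that] f[of l]] by simp
  have "(\<integral>\<^sup>+v. h (restrict v {..<k}) * (\<Prod>j<Suc l. f j (restrict v {..<k}) (v (k + j))) \<partial>?P (k + Suc l))
    = (\<integral>\<^sup>+v. \<integral>\<^sup>+y. h (restrict (v(k + l := y)) {..<k}) *
        (\<Prod>j<Suc l. f j (restrict (v(k + l := y)) {..<k}) ((v(k + l := y)) (k + j))) \<partial>M \<partial>?P (k + l))"
    unfolding add_Suc_right lessThan_Suc[of "k + l"]
  proof (rule product_nn_integral_insert)
    have "(\<lambda>v. h (restrict v {..<k}) * (\<Prod>j<Suc l. f j (restrict v {..<k}) (v (k + j))))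
      \<in> borel_measurable (?P (k + Suc l))"
      by (intro borel_measurable_times_ennreal borel_measurable_prod_ennreal fm measurable_compose[OF R h]) simp
    then show "(\<lambda>v. h (restrict v {..<k}) *
        (\<Prod>j<Suc l. f j (restrict v {..<k}) (v (k + j))))
      \<in> borel_measurable (PiM (insert (k + l) {..<k + l}) (\<lambda>_. M))"
      by (simp only: add_Suc_right lessThan_Suc[of "k + l"])
  qed auto
  also have "\<dots> = (\<integral>\<^sup>+v. (\<lambda>w. h w * (\<integral>\<^sup>+z. f l w z \<partial>M)) (restrict v {..<k}) *
        (\<Prod>j<l. f j (restrict v {..<k}) (v (k + j))) \<partial>?P (k + l))"
  proof (rule nn_integral_cong)
    fix v assume v: "v \<in> space (?P (k + l))"
    have r: "restrict (v(k + l := y)) {..<k} = restrict v {..<k}" for y by (auto simp: restrict_def)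
    have p: "(\<Prod>j<l. f j w ((v(k + l := y)) (k + j))) = (\<Prod>j<l. f j w (v (k + j)))" for w y
      by (intro prod.cong) auto
    have "(\<integral>\<^sup>+y. h (restrict (v(k + l := y)) {..<k}) *
        (\<Prod>j<Suc l. f j (restrict (v(k + l := y)) {..<k}) ((v(k + l := y)) (k + j))) \<partial>M)
      = (\<integral>\<^sup>+y. (h (restrict v {..<k}) * (\<Prod>j<l. f j (restrict v {..<k}) (v (k + j))))
         * f l (restrict v {..<k}) y \<partial>M)"
      by (simp only: r prod.lessThan_Suc p) (simp add: mult.assoc)
    also have "\<dots> = (h (restrict v {..<k}) * (\<Prod>j<l. f j (restrict v {..<k}) (v (k + j))))
         * (\<integral>\<^sup>+y. f l (restrict v {..<k}) y \<partial>M)"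
      by (rule nn_integral_cmult[OF fl[OF measurable_space[OF R v]]])
    finally show "(\<integral>\<^sup>+y. h (restrict (v(k + l := y)) {..<k}) *
        (\<Prod>j<Suc l. f j (restrict (v(k + l := y)) {..<k}) ((v(k + l := y)) (k + j))) \<partial>M)
      = (\<lambda>w. h w * (\<integral>\<^sup>+z. f l w z \<partial>M)) (restrict v {..<k}) *
        (\<Prod>j<l. f j (restrict v {..<k}) (v (k + j)))"
      by (simp add: mult_ac)
  qed
  also have "\<dots> = (\<integral>\<^sup>+w. (\<lambda>w. h w * (\<integral>\<^sup>+z. f l w z \<partial>M)) w * (\<Prod>j<l. \<integral>\<^sup>+z. f j w z \<partial>M) \<partial>?P k)"
    by (rule Suc.IH) measurable
  finally show ?case by (simp only: prod.lessThan_Suc mult_ac)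
qed

text \<open>The event of never visiting \<open>A\<close> is contained in the event of missing it
  \<open>n\<close> times, which has probability \<open>(1 - prob A) ^ n\<close>; let
  \<open>n\<close> tend to infinity.\<close>

lemma (in prob_space) AE_PiM_visits:
  assumes A: "A \<in> events" "prob A > 0"
  shows "AE w in PiM UNIV (\<lambda>_::nat. M). \<exists>i. w i \<in> A"
proof -
  interpret P: product_prob_space "\<lambda>_::nat. M" UNIV by unfold_locales
  let ?S = "PiM UNIV (\<lambda>_::nat. M)"
  let ?N = "{w \<in> space ?S. \<forall>i. w i \<notin> A}"
  have N: "?N \<in> sets ?S" using A by measurable
  have "emeasure ?S ?N \<le> ennreal ((1 - prob A) ^ n)" for n
  proof -
    have "?N \<subseteq> prod_emb UNIV (\<lambda>_. M) {..<n} (Pi\<^sub>E {..<n} (\<lambda>_. space M - A))"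
      by (auto simp: prod_emb_def space_PiM PiE_iff)
    then have "emeasure ?S ?N \<le> emeasure ?S (prod_emb UNIV (\<lambda>_. M) {..<n} (Pi\<^sub>E {..<n} (\<lambda>_. space M - A)))"
      by (intro emeasure_mono sets_PiM_I) (use A in auto)
    also have "\<dots> = (\<Prod>i<n. emeasure M (space M - A))"
      by (rule P.emeasure_PiM_emb) (use A in auto)
    also have "\<dots> = ennreal ((1 - prob A) ^ n)"
      using A by (simp add: emeasure_eq_measure prob_compl ennreal_power)
    finally show ?thesis .
  qed
  moreover have "(\<lambda>n. ennreal ((1 - prob A) ^ n)) \<longlonglongrightarrow> ennreal 0"
    using A by (intro tendsto_ennrealI LIMSEQ_realpow_zero) auto
  ultimately have "emeasure ?S ?N \<le> 0"
    by (intro LIMSEQ_le_const[of "\<lambda>n. ennreal ((1 - prob A) ^ n)"]) auto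
  then have "?N \<in> null_sets ?S" using N by auto
  then show ?thesis by (rule AE_I') auto
qed

context compact_metric_prob
begin

text \<open>Almost surely the images under \<open>f\<close> visit every basic set of positive
  measure, as these are countably many. Every neighbourhood of a support point contains the trace on
  \<open>X\<close> of such a set, so a single null set serves all \<open>U\<close> and
  \<open>p\<close>.\<close>

lemma AE_samples_dense_in_support:
  assumes L: "prob_space L" and f[measurable]: "f \<in> L \<rightarrow>\<^sub>M \<mu>" and d: "distr L \<mu> f = \<mu>"
  shows "AE w in PiM UNIV (\<lambda>_::nat. L).
    \<forall>U p. open U \<longrightarrow> p \<in> U \<longrightarrow> p \<in> support \<longrightarrow> (\<exists>i. f (w i) \<in> U)"
proof -
  interpret L: prob_space L by fact
  obtain \<B> where \<B>: "countable \<B>" "\<And>B. B \<in> \<B> \<Longrightarrow> open B"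
    "\<And>U x. open U \<Longrightarrow> x \<in> U \<Longrightarrow> x \<in> X \<Longrightarrow> \<exists>B\<in>\<B>. x \<in> B \<and> B \<inter> X \<subseteq> U"
    using compact_countable_base[OF compact_X] by metis
  have "AE w in PiM UNIV (\<lambda>_::nat. L). \<forall>B\<in>\<B>. prob (B \<inter> X) > 0 \<longrightarrow> (\<exists>i. f (w i) \<in> B \<inter> X)"
  proof (subst AE_ball_countable[OF \<B>(1)], intro ballI AE_impI)
    fix B assume B: "B \<in> \<B>" "prob (B \<inter> X) > 0"
    then have m[measurable]: "B \<inter> X \<in> sets \<mu>" using \<B>(2) open_Int_sets by auto
    have "prob (B \<inter> X) = L.prob (f -` (B \<inter> X) \<inter> space L)"
      using measure_distr[OF f m] d by simp
    then have "AE w in PiM UNIV (\<lambda>_::nat. L). \<exists>i. w i \<in> f -` (B \<inter> X) \<inter> space L"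
      using B measurable_sets[OF f m] by (intro L.AE_PiM_visits) auto
    then show "AE w in PiM UNIV (\<lambda>_::nat. L). \<exists>i. f (w i) \<in> B \<inter> X" by eventually_elim auto
  qed
  then show ?thesis
  proof eventually_elim
    case (elim w)
    show ?case
    proof (intro allI impI)
      fix U p assume U: "open U" "p \<in> U" "p \<in> support"
      then obtain B where B: "B \<in> \<B>" "p \<in> B" "B \<inter> X \<subseteq> U" using \<B>(3)[of U p] support_subset by auto
      then have "prob (B \<inter> X) > 0" using U(3) \<B>(2) unfolding support_def by auto
      then obtain i where "f (w i) \<in> B \<inter> X" using elim B(1) by metis
      then show "\<exists>i. f (w i) \<in> U" using B(3) by blast
    qed
  qed
qed

text \<open>Induction over the generation of the Borel sets of \<open>X\<close> by open sets. The
  points \<open>x i\<close> are dense only near \<open>P\<close>, later the support, so a set of the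
  generated sigma-algebra can be matched with the preimage of \<open>A\<close> only where
  \<open>f z \<in> P\<close>. Finite intersections of balls, rather than single balls, are taken so
  that the generator is stable under intersection.\<close>

lemma sets_generated_by_balls:
  fixes f :: "'z \<Rightarrow> 'a" and x :: "nat \<Rightarrow> 'a"
  assumes f: "f \<in> \<Omega> \<rightarrow> X" and dense: "\<And>U p. open U \<Longrightarrow> p \<in> U \<Longrightarrow> p \<in> P \<Longrightarrow> \<exists>i. x i \<in> U"
    and A: "A \<in> sets \<mu>"
  defines "E \<equiv> range (\<lambda>R::(nat \<times> rat) list. {z\<in>\<Omega>. \<forall>(i, q)\<in>set R. dist (f z) (x i) < of_rat q})"
  shows "\<exists>D\<in>sigma_sets \<Omega> E. \<forall>z\<in>\<Omega>. f z \<in> P \<longrightarrow> (z \<in> D \<longleftrightarrow> f z \<in> A)"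
proof -
  have EP: "E \<subseteq> Pow \<Omega>" unfolding E_def by auto
  interpret S: sigma_algebra \<Omega> "sigma_sets \<Omega> E" by (rule sigma_algebra_sigma_sets[OF EP])
  have bor: "sets (borel :: 'a measure) = sigma_sets UNIV {U. open U}"
    by (simp add: borel_def)
  have "sets \<mu> = (\<inter>) X ` sigma_sets UNIV {U. open U}"
    by (simp add: sets_eq bor sets_restrict_space)
  also have "\<dots> = sigma_sets X ((\<inter>) X ` {U. open U})"
    using borel_closed[OF compact_imp_closed[OF compact_X]]
    by (intro sigma_sets_Int) (auto simp: bor)
  finally have "A \<in> sigma_sets X ((\<inter>) X ` {U. open U})" using A by simp
  then show ?thesis
  proof induction
    case (Basic A)
    then obtain U where U: "open U" "A = X \<inter> U" by auto
    \<comment> \<open>The set \<open>U\<close> is approximated by all balls inside it that have a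
      centre \<open>x i\<close> and a rational radius; their union covers every point of
      \<open>U\<close> that lies in \<open>P\<close>.\<close>
    let ?I = "{(i, q). ball (x i) (of_rat q) \<subseteq> U}"
    have "(\<Union>(i, q)\<in>?I. {z\<in>\<Omega>. dist (f z) (x i) < of_rat q}) \<in> sigma_sets \<Omega> E"
    proof (rule S.countable_UN'')
      fix p :: "nat \<times> rat"
      have "{z\<in>\<Omega>. \<forall>(i, q)\<in>set [p]. dist (f z) (x i) < of_rat q} \<in> E" unfolding E_def by (rule rangeI)
      then show "(case p of (i, q) \<Rightarrow> {z\<in>\<Omega>. dist (f z) (x i) < of_rat q}) \<in> sigma_sets \<Omega> E"
        by (auto simp: case_prod_beta')
    qed auto
    moreover have "z \<in> (\<Union>(i, q)\<in>?I. {z\<in>\<Omega>. dist (f z) (x i) < of_rat q}) \<longleftrightarrow> f z \<in> A"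
      if z: "z \<in> \<Omega>" "f z \<in> P" for z
    proof
      assume "z \<in> (\<Union>(i, q)\<in>?I. {z\<in>\<Omega>. dist (f z) (x i) < of_rat q})"
      then show "f z \<in> A" using U f z by (auto simp: dist_commute)
    next
      assume "f z \<in> A"
      then obtain e where e: "e > 0" "ball (f z) e \<subseteq> U" using U open_contains_ball by blast
      \<comment> \<open>A radius below \<open>e / 2\<close> keeps a ball that contains
        \<open>f z\<close> inside the ball of radius \<open>e\<close> around
        \<open>f z\<close>.\<close>
      obtain q where q: "0 < real_of_rat q" "real_of_rat q < e / 2"
        using of_rat_dense[of 0 "e / 2"] e by (metis half_gt_zero)
      obtain i where i: "x i \<in> ball (f z) (of_rat q)" using dense[of "ball (f z) (of_rat q)" "f z"] q z by auto
      have "ball (x i) (of_rat q) \<subseteq> ball (f z) e"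
      proof
        fix y assume "y \<in> ball (x i) (of_rat q)"
        then show "y \<in> ball (f z) e" using i q dist_triangle[of "f z" y "x i"] by simp
      qed
      then have "(i, q) \<in> ?I" using e by auto
      then show "z \<in> (\<Union>(i, q)\<in>?I. {z\<in>\<Omega>. dist (f z) (x i) < of_rat q})" using i z by auto
    qed
    ultimately show ?case by blast
  next
    case Empty
    then show ?case by (intro bexI[of _ "{}"]) auto
  next
    case (Compl A)
    then obtain D where D: "D \<in> sigma_sets \<Omega> E" "\<forall>z\<in>\<Omega>. f z \<in> P \<longrightarrow> (z \<in> D \<longleftrightarrow> f z \<in> A)" by auto
    then show ?case using f by (intro bexI[of _ "\<Omega> - D"]) auto
  next
    case (Union A)
    then obtain D where D: "\<And>i. D i \<in> sigma_sets \<Omega> E"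
      "\<And>i. \<forall>z\<in>\<Omega>. f z \<in> P \<longrightarrow> (z \<in> D i \<longleftrightarrow> f z \<in> A i)" by metis
    then show ?case by (intro bexI[of _ "\<Union>i. D i"]) auto
  qed
qed

end

section \<open>Couplings and measurability of their distance matrices\<close>

text \<open>The sigma-algebra is given as the product one, so that product measures and sections can
  be used; for joinings it agrees with the Borel one by
  \<open>sets_restrict_borel_Times\<close>.\<close>

locale system_coupling = MX: compact_metric_prob \<mu> X + MY: compact_metric_prob \<nu> Y + prob_space L
  for \<mu> :: "'a::metric_space measure" and X and \<nu> :: "'b::metric_space measure" and Y
    and L :: "('a \<times> 'b) measure" +
  fixes T :: "'a \<Rightarrow> 'a" and S :: "'b \<Rightarrow> 'b"
  assumes sets_L[measurable_cong]: "sets L = sets (\<mu> \<Otimes>\<^sub>M \<nu>)"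
    and distr_fst: "distr L \<mu> fst = \<mu>"
    and distr_snd: "distr L \<nu> snd = \<nu>"
    and T[measurable]: "T \<in> \<mu> \<rightarrow>\<^sub>M \<mu>"
    and S[measurable]: "S \<in> \<nu> \<rightarrow>\<^sub>M \<nu>"
begin

lemma space_L: "space L = X \<times> Y"
  using sets_eq_imp_space_eq[OF sets_L] by (simp add: space_pair_measure MX.space_eq MY.space_eq)

lemma fst_measurable[measurable]: "fst \<in> L \<rightarrow>\<^sub>M \<mu>"
  and snd_measurable[measurable]: "snd \<in> L \<rightarrow>\<^sub>M \<nu>"
  by measurable

lemma T_pow[measurable]: "T ^^ a \<in> \<mu> \<rightarrow>\<^sub>M \<mu>"
  and S_pow[measurable]: "S ^^ a \<in> \<nu> \<rightarrow>\<^sub>M \<nu>"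
  by (induction a) (auto simp: comp_def intro: measurable_compose)

lemma DX_measurable[measurable]: "DX T n m \<in> PiM {..<n} (\<lambda>_. L) \<rightarrow>\<^sub>M mat_space n m"
proof -
  have "(\<lambda>z. dist ((T ^^ a) (fst (z i))) ((T ^^ b) (fst (z j)))) \<in> borel_measurable (PiM {..<n} (\<lambda>_. L))"
    if [measurable]: "i \<in> {..<n}" "j \<in> {..<n}" for i j a b
    by (intro MX.measurable_dist measurable_compose[OF _ T_pow] measurable_compose[OF _ fst_measurable]
        measurable_component_singleton that)
  then show ?thesis unfolding DX_def mat_space_def
    by (intro measurable_restrict) (auto simp: mat_idx_def)
qed

lemma DY_measurable[measurable]: "DY S n m \<in> PiM {..<n} (\<lambda>_. L) \<rightarrow>\<^sub>M mat_space n m"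
proof -
  have "(\<lambda>z. dist ((S ^^ a) (snd (z i))) ((S ^^ b) (snd (z j)))) \<in> borel_measurable (PiM {..<n} (\<lambda>_. L))"
    if "i \<in> {..<n}" "j \<in> {..<n}" for i j a b
    by (intro MY.measurable_dist measurable_compose[OF _ S_pow] measurable_compose[OF _ snd_measurable]
        measurable_component_singleton that)
  then show ?thesis unfolding DY_def mat_space_def
    by (intro measurable_restrict) (auto simp: mat_idx_def)
qed

end

section \<open>Finite intersections of balls around sampled points\<close>

text \<open>A list of centre indices and rational radii codes a finite intersection of balls. There
  are countably many lists, so almost sure statements hold for all of them at once; concatenation is
  intersection, and the empty list is no condition.\<close>

definition near :: "('z \<Rightarrow> 'c::metric_space) \<Rightarrow> (nat \<times> rat) list \<Rightarrow> (nat \<Rightarrow> 'z) \<Rightarrow> 'z \<Rightarrow> bool" where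
  "near f R w z \<longleftrightarrow> (\<forall>(i, q)\<in>set R. dist (f z) (f (w i)) < of_rat q)"

lemma near_cong: "\<forall>(i, q)\<in>set R. w i = w' i \<Longrightarrow> near f R w z = near f R w' z"
  unfolding near_def by fastforce

lemma (in compact_metric_prob) near_measurable:
  assumes f: "f \<in> N \<rightarrow>\<^sub>M \<mu>" and R: "\<forall>(i, q)\<in>set R. i < k"
    and w: "w \<in> M' \<rightarrow>\<^sub>M PiM {..<k} (\<lambda>_. N)" and z: "z \<in> M' \<rightarrow>\<^sub>M N"
  shows "Measurable.pred M' (\<lambda>x. near f R (w x) (z x))"
proof -
  have "Measurable.pred M' (\<lambda>x. case p of (i, q) \<Rightarrow> dist (f (z x)) (f (w x i)) < of_rat q)" if "p \<in> set R" for p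
  proof -
    have "fst p \<in> {..<k}" using R that by auto
    from measurable_compose[OF measurable_compose[OF w measurable_component_singleton[OF this]] f]
    have [measurable]: "(\<lambda>x. f (w x (fst p))) \<in> M' \<rightarrow>\<^sub>M \<mu>" .
    have [measurable]: "(\<lambda>x. f (z x)) \<in> M' \<rightarrow>\<^sub>M \<mu>" by (rule measurable_compose[OF z f])
    show ?thesis unfolding case_prod_beta' by measurable
  qed
  then show ?thesis unfolding near_def by (intro pred_intros_finite) auto
qed

context system_coupling
begin

lemma Times_distr_fst: "A \<in> sets \<mu> \<Longrightarrow> prob (A \<times> Y) = measure \<mu> A"
  using measure_distr[OF fst_measurable, of A] sets.sets_into_space[of A \<mu>]
  by (simp add: distr_fst space_L MX.space_eq)
     (rule arg_cong[where f=prob], auto)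

lemma Times_distr_snd: "B \<in> sets \<nu> \<Longrightarrow> prob (X \<times> B) = measure \<nu> B"
  using measure_distr[OF snd_measurable, of B] sets.sets_into_space[of B \<nu>]
  by (simp add: distr_snd space_L MY.space_eq)
     (rule arg_cong[where f=prob], auto)

text \<open>The first \<open>k\<close> sample points are the centres of the balls, the last four are tested: for
  \<open>(p, q)\<close> equal to \<open>(0, 1)\<close>, \<open>(0, 2)\<close>, \<open>(2, 3)\<close> the conditional probability given the centres is
  \<open>a\<^sup>2\<close>, \<open>a b c\<close>, \<open>b\<^sup>2 c\<^sup>2\<close> respectively.\<close>
definition config :: "nat \<Rightarrow> (nat \<times> rat) list \<Rightarrow> (nat \<times> rat) list \<Rightarrow> nat \<Rightarrow> nat \<Rightarrow> (nat \<Rightarrow> 'a \<times> 'b) set" where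
  "config k Q R p q = {\<omega> \<in> space (PiM {..<k + 4} (\<lambda>_. L)).
     near fst Q \<omega> (\<omega> k) \<and> near fst Q \<omega> (\<omega> (k + 1)) \<and>
     near snd R \<omega> (\<omega> (k + p)) \<and> near snd R \<omega> (\<omega> (k + q))}"

text \<open>Given the centres, the four tested points are independent: point \<open>j\<close> has to
  satisfy the condition on \<open>X\<close> if \<open>j < 2\<close> and the one on \<open>Y\<close>
  if \<open>j\<close> is \<open>p\<close> or \<open>q\<close>. The indicator of the event is thus a
  product of four factors, to which \<open>nn_integral_PiM_split\<close> applies.\<close>

lemma emeasure_config:
  assumes Q: "\<forall>(i, q)\<in>set Q. i < k" and R: "\<forall>(i, q)\<in>set R. i < k" and pq: "p < 4" "q < 4"
  shows "emeasure (PiM {..<k + 4} (\<lambda>_. L)) (config k Q R p q) =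
    (\<integral>\<^sup>+w. (\<Prod>j<4. emeasure L {z \<in> space L. (j < 2 \<longrightarrow> near fst Q w z) \<and> (j = p \<or> j = q \<longrightarrow> near snd R w z)})
      \<partial>PiM {..<k} (\<lambda>_. L))"
proof -
  let ?P = "\<lambda>n. PiM {..<n} (\<lambda>_. L)"
  let ?C = "\<lambda>j w z. (j < 2 \<longrightarrow> near fst Q w z) \<and> (j = p \<or> j = q \<longrightarrow> near snd R w z)"
  have r: "(\<lambda>\<omega>. restrict \<omega> {..<k}) \<in> ?P (k + 4) \<rightarrow>\<^sub>M ?P k" by (intro measurable_restrict_subset) auto
  have near_restrict: "near fst Q (restrict \<omega> {..<k}) z = near fst Q \<omega> z"
    "near snd R (restrict \<omega> {..<k}) z = near snd R \<omega> z" for \<omega> z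
    using Q R by (auto intro!: near_cong)
  have nm: "Measurable.pred M' (\<lambda>x. near fst Q (w x) (z x))" "Measurable.pred M' (\<lambda>x. near snd R (w x) (z x))"
    if "w \<in> M' \<rightarrow>\<^sub>M ?P k" "z \<in> M' \<rightarrow>\<^sub>M L" for M' :: "'c measure" and w z
    by (rule MX.near_measurable[OF fst_measurable Q that] MY.near_measurable[OF snd_measurable R that])+
  have cm: "Measurable.pred M' (\<lambda>x. ?C j (w x) (z x))"
    if "w \<in> M' \<rightarrow>\<^sub>M ?P k" "z \<in> M' \<rightarrow>\<^sub>M L" for M' :: "'c measure" and w z j
    using nm[OF that] by measurable
  have config: "\<omega> \<in> config k Q R p q \<longleftrightarrow> (\<forall>j<4. ?C j (restrict \<omega> {..<k}) (\<omega> (k + j)))"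
    if "\<omega> \<in> space (?P (k + 4))" for \<omega>
    unfolding near_restrict
  proof
    assume "\<omega> \<in> config k Q R p q"
    then show "\<forall>j<4. ?C j \<omega> (\<omega> (k + j))"
      unfolding config_def by (auto simp: less_2_cases_iff)
  next
    assume *: "\<forall>j<4. ?C j \<omega> (\<omega> (k + j))"
    show "\<omega> \<in> config k Q R p q"
      unfolding config_def using that pq *[rule_format, of 0] *[rule_format, of 1]
        *[rule_format, of p] *[rule_format, of q] by simp
  qed
  have ms: "config k Q R p q \<in> sets (?P (k + 4))"
  proof -
    have "Measurable.pred (?P (k + 4)) (\<lambda>\<omega>. ?C j (restrict \<omega> {..<k}) (\<omega> (k + j)))"
      if "j \<in> {..<4}" for j
      by (rule cm[OF r measurable_component_singleton]) (use that in auto)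
    then have "Measurable.pred (?P (k + 4)) (\<lambda>\<omega>. \<forall>j\<in>{..<4}. ?C j (restrict \<omega> {..<k}) (\<omega> (k + j)))"
      by (rule pred_intros_finite(3)[rotated]) simp_all
    then have "{\<omega> \<in> space (?P (k + 4)). \<forall>j\<in>{..<4}. ?C j (restrict \<omega> {..<k}) (\<omega> (k + j))} \<in> sets (?P (k + 4))"
      by (rule predE)
    also have "{\<omega> \<in> space (?P (k + 4)). \<forall>j\<in>{..<4}. ?C j (restrict \<omega> {..<k}) (\<omega> (k + j))} = config k Q R p q"
      using config by (auto simp: config_def)
    finally show ?thesis .
  qed
  have "emeasure (?P (k + 4)) (config k Q R p q) = (\<integral>\<^sup>+\<omega>. indicator (config k Q R p q) \<omega> \<partial>?P (k + 4))"
    using ms by simp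
  also have "\<dots> = (\<integral>\<^sup>+\<omega>. 1 * (\<Prod>j<4. (indicator {z \<in> space L. ?C j (restrict \<omega> {..<k}) z} (\<omega> (k + j)))) \<partial>?P (k + 4))"
  proof (rule nn_integral_cong)
    fix \<omega> assume \<omega>: "\<omega> \<in> space (?P (k + 4))"
    then have sp: "\<omega> (k + j) \<in> space L" if "j < 4" for j using that by (auto simp: space_PiM PiE_iff)
    have "(\<Prod>j<4. indicator {z \<in> space L. ?C j (restrict \<omega> {..<k}) z} (\<omega> (k + j))) =
      (if \<forall>j<4. ?C j (restrict \<omega> {..<k}) (\<omega> (k + j)) then 1 else 0 :: ennreal)"
    proof (cases "\<forall>j<4. ?C j (restrict \<omega> {..<k}) (\<omega> (k + j))")
      case True
      then have "(\<Prod>j<4. indicator {z \<in> space L. ?C j (restrict \<omega> {..<k}) z} (\<omega> (k + j))) = (1 :: ennreal)"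
        using sp by (intro prod.neutral) (auto simp: indicator_def)
      with True show ?thesis by (simp only: if_P if_True)
    next
      case False
      then obtain j where j: "j < 4" "\<not> ?C j (restrict \<omega> {..<k}) (\<omega> (k + j))" by auto
      then have "(\<Prod>j<4. indicator {z \<in> space L. ?C j (restrict \<omega> {..<k}) z} (\<omega> (k + j))) = (0 :: ennreal)"
        by (intro prod_zero bexI[of _ j]) (auto simp: indicator_def)
      with False show ?thesis by (simp only: if_not_P if_False)
    qed
    then show "indicator (config k Q R p q) \<omega> =
      1 * (\<Prod>j<4. indicator {z \<in> space L. ?C j (restrict \<omega> {..<k}) z} (\<omega> (k + j)) :: ennreal)"
      using config[OF \<omega>] by (simp add: indicator_def)
  qed
  also have "\<dots> = (\<integral>\<^sup>+w. 1 * (\<Prod>j<4. \<integral>\<^sup>+z. indicator {z \<in> space L. ?C j w z} z \<partial>L) \<partial>?P k)"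
  proof (rule nn_integral_PiM_split)
    fix j
    have "Measurable.pred (?P k \<Otimes>\<^sub>M L) (\<lambda>x. ?C j (fst x) (snd x))"
      by (rule cm[OF measurable_fst measurable_snd])
    then have "(\<lambda>p. indicator {x \<in> space (?P k \<Otimes>\<^sub>M L). ?C j (fst x) (snd x)} p :: ennreal) \<in> borel_measurable (?P k \<Otimes>\<^sub>M L)"
      by (rule borel_measurable_indicator[OF predE])
    then show "(\<lambda>p. indicator {z \<in> space L. ?C j (fst p) z} (snd p) :: ennreal) \<in> borel_measurable (?P k \<Otimes>\<^sub>M L)"
      by (rule measurable_cong[THEN iffD1, rotated]) (auto simp: space_pair_measure indicator_def)
  qed simp
  also have "\<dots> = (\<integral>\<^sup>+w. (\<Prod>j<4. emeasure L {z \<in> space L. ?C j w z}) \<partial>?P k)"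
  proof (rule nn_integral_cong)
    fix w assume w: "w \<in> space (?P k)"
    have "(\<integral>\<^sup>+z. indicator {z \<in> space L. ?C j w z} z \<partial>L) = emeasure L {z \<in> space L. ?C j w z}" for j
      by (rule nn_integral_indicator[OF predE[OF cm[OF measurable_const[OF w] measurable_ident_sets[OF refl]]]])
    then show "1 * (\<Prod>j<4. \<integral>\<^sup>+z. indicator {z \<in> space L. ?C j w z} z \<partial>L) =
      (\<Prod>j<4. emeasure L {z \<in> space L. ?C j w z})" by (simp only: mult_1_left)
  qed
  finally show ?thesis .
qed

text \<open>This is \<open>config\<close> read off the two matrices: rows are tested points, columns
  are centres, all times are 0. It does not mention \<open>L\<close>, so one and the same event is
  evaluated for \<open>L\<close> and for the product.\<close>

definition mat_config :: "nat \<Rightarrow> (nat \<times> rat) list \<Rightarrow> (nat \<times> rat) list \<Rightarrow> nat \<Rightarrow> nat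
    \<Rightarrow> (((nat \<times> nat) \<times> (nat \<times> nat) \<Rightarrow> real) \<times> ((nat \<times> nat) \<times> (nat \<times> nat) \<Rightarrow> real)) set" where
  "mat_config k Q R p q = {D \<in> space (mat_space (k + 4) 1 \<Otimes>\<^sub>M mat_space (k + 4) 1).
     (\<forall>(i, r)\<in>set Q. fst D ((k, 0), (i, 0)) < of_rat r \<and> fst D ((k + 1, 0), (i, 0)) < of_rat r) \<and>
     (\<forall>(i, r)\<in>set R. snd D ((k + p, 0), (i, 0)) < of_rat r \<and> snd D ((k + q, 0), (i, 0)) < of_rat r)}"

text \<open>\<open>config\<close> is the preimage of \<open>mat_config\<close> under the map to the
  distance matrices, so its probability depends on \<open>L\<close> only through
  \<open>Phi\<close>.\<close>

lemma emeasure_config_Phi: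
  assumes Q: "\<forall>(i, q)\<in>set Q. i < k" and R: "\<forall>(i, q)\<in>set R. i < k" and pq: "p < 4" "q < 4"
  shows "emeasure (PiM {..<k + 4} (\<lambda>_. L)) (config k Q R p q) =
    emeasure (Phi T S (k + 4) 1 L) (mat_config k Q R p q)"
proof -
  let ?MM = "mat_space (k + 4) 1 \<Otimes>\<^sub>M mat_space (k + 4) 1"
  have c: "(\<lambda>D. fst D ((i, 0), (j, 0))) \<in> borel_measurable ?MM"
    "(\<lambda>D. snd D ((i, 0), (j, 0))) \<in> borel_measurable ?MM" if "i < k + 4" "j < k + 4" for i j
    unfolding mat_space_def
    by (intro measurable_compose[OF measurable_fst measurable_component_singleton]
          measurable_compose[OF measurable_snd measurable_component_singleton],
        use that in \<open>auto simp: mat_idx_def\<close>)+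
  have mQ: "Measurable.pred ?MM (\<lambda>D. \<forall>x\<in>set Q. fst D ((k, 0), (fst x, 0)) < of_rat (snd x) \<and> fst D ((k + 1, 0), (fst x, 0)) < of_rat (snd x))"
  proof (rule pred_intros_finite)
    fix x assume "x \<in> set Q"
    then have "fst x < k" using Q by auto
    then have [measurable]: "(\<lambda>D. fst D ((k, 0), (fst x, 0))) \<in> borel_measurable ?MM"
      "(\<lambda>D. fst D ((k + 1, 0), (fst x, 0))) \<in> borel_measurable ?MM"
      using c(1)[of k "fst x"] c(1)[of "k + 1" "fst x"] by simp_all
    show "Measurable.pred ?MM (\<lambda>D. fst D ((k, 0), (fst x, 0)) < of_rat (snd x) \<and> fst D ((k + 1, 0), (fst x, 0)) < of_rat (snd x))"
      by measurable
  qed simp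
  have mR: "Measurable.pred ?MM (\<lambda>D. \<forall>x\<in>set R. snd D ((k + p, 0), (fst x, 0)) < of_rat (snd x) \<and> snd D ((k + q, 0), (fst x, 0)) < of_rat (snd x))"
  proof (rule pred_intros_finite)
    fix x assume "x \<in> set R"
    then have "fst x < k" using R by auto
    then have [measurable]: "(\<lambda>D. snd D ((k + p, 0), (fst x, 0))) \<in> borel_measurable ?MM"
      "(\<lambda>D. snd D ((k + q, 0), (fst x, 0))) \<in> borel_measurable ?MM"
      using c(2)[of "k + p" "fst x"] c(2)[of "k + q" "fst x"] pq by simp_all
    show "Measurable.pred ?MM (\<lambda>D. snd D ((k + p, 0), (fst x, 0)) < of_rat (snd x) \<and> snd D ((k + q, 0), (fst x, 0)) < of_rat (snd x))"
      by measurable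
  qed simp
  have "mat_config k Q R p q \<in> sets ?MM"
    unfolding mat_config_def case_prod_beta' using mQ mR by measurable
  moreover have "(\<lambda>z. (DX T (k + 4) 1 z, DY S (k + 4) 1 z)) \<in> PiM {..<k + 4} (\<lambda>_. L) \<rightarrow>\<^sub>M ?MM"
    by measurable
  moreover have "(\<lambda>z. (DX T (k + 4) 1 z, DY S (k + 4) 1 z)) -` mat_config k Q R p q \<inter> space (PiM {..<k + 4} (\<lambda>_. L))
    = config k Q R p q"
  proof -
    have x: "DX T (k + 4) 1 \<omega> ((a, 0), (i, 0)) = dist (fst (\<omega> a)) (fst (\<omega> i))"
      "DY S (k + 4) 1 \<omega> ((a, 0), (i, 0)) = dist (snd (\<omega> a)) (snd (\<omega> i))"
      if "a < k + 4" "i < k + 4" for \<omega> a i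
      using that by (auto simp: DX_def DY_def mat_idx_def)
    have QR: "\<forall>x\<in>set Q. fst x < k + 4" "\<forall>x\<in>set R. fst x < k + 4" using Q R by auto
    have eq1: "(\<forall>(i, r)\<in>set Q. DX T (k + 4) 1 \<omega> ((k, 0), (i, 0)) < of_rat r \<and> DX T (k + 4) 1 \<omega> ((k + 1, 0), (i, 0)) < of_rat r)
       \<longleftrightarrow> near fst Q \<omega> (\<omega> k) \<and> near fst Q \<omega> (\<omega> (k + 1))" for \<omega> :: "nat \<Rightarrow> 'a \<times> 'b"
    proof -
      have "(\<forall>(i, r)\<in>set Q. DX T (k + 4) 1 \<omega> ((k, 0), (i, 0)) < of_rat r \<and> DX T (k + 4) 1 \<omega> ((k + 1, 0), (i, 0)) < of_rat r)
       \<longleftrightarrow> (\<forall>(i, r)\<in>set Q. dist (fst (\<omega> k)) (fst (\<omega> i)) < of_rat r \<and> dist (fst (\<omega> (k + 1))) (fst (\<omega> i)) < of_rat r)"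
        using QR unfolding case_prod_beta' by (intro ball_cong) (simp_all add: x[unfolded One_nat_def])
      then show ?thesis unfolding near_def by auto
    qed
    have eq2: "(\<forall>(i, r)\<in>set R. DY S (k + 4) 1 \<omega> ((k + p, 0), (i, 0)) < of_rat r \<and> DY S (k + 4) 1 \<omega> ((k + q, 0), (i, 0)) < of_rat r)
       \<longleftrightarrow> near snd R \<omega> (\<omega> (k + p)) \<and> near snd R \<omega> (\<omega> (k + q))" for \<omega> :: "nat \<Rightarrow> 'a \<times> 'b"
    proof -
      have "(\<forall>(i, r)\<in>set R. DY S (k + 4) 1 \<omega> ((k + p, 0), (i, 0)) < of_rat r \<and> DY S (k + 4) 1 \<omega> ((k + q, 0), (i, 0)) < of_rat r)
       \<longleftrightarrow> (\<forall>(i, r)\<in>set R. dist (snd (\<omega> (k + p))) (snd (\<omega> i)) < of_rat r \<and> dist (snd (\<omega> (k + q))) (snd (\<omega> i)) < of_rat r)"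
        using QR pq unfolding case_prod_beta' by (intro ball_cong) (simp_all add: x[unfolded One_nat_def])
      then show ?thesis unfolding near_def by auto
    qed
    have sp: "(DX T (k + 4) 1 \<omega>, DY S (k + 4) 1 \<omega>) \<in> space ?MM" for \<omega> :: "nat \<Rightarrow> 'a \<times> 'b"
      by (auto simp: space_pair_measure mat_space_def space_PiM DX_def DY_def)
    show ?thesis unfolding config_def mat_config_def using sp eq1 eq2 by auto
  qed
  ultimately show ?thesis unfolding Phi_def by (subst emeasure_distr) auto
qed

end

lemma near_Nil[simp]: "near f [] w z"
  by (simp add: near_def)

lemma near_append: "near f (Q @ R) w z \<longleftrightarrow> near f Q w z \<and> near f R w z"
  by (auto simp: near_def)

lemma open_near: "open {x. near (\<lambda>x. x) Q w x}"
proof -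
  have "{x. near (\<lambda>x. x) Q w x} = (\<Inter>p\<in>set Q. ball (w (fst p)) (of_rat (snd p)))"
    by (auto simp: near_def dist_commute)
  then show ?thesis by (simp add: open_INT)
qed

lemma near_comp: "near f Q w z \<longleftrightarrow> near (\<lambda>x. x) Q (\<lambda>i. f (w i)) (f z)"
  by (simp add: near_def)

lemma product_coupling:
  assumes "compact_metric_prob \<mu> X" and "compact_metric_prob \<nu> Y"
    and T: "T \<in> \<mu> \<rightarrow>\<^sub>M \<mu>" and S: "S \<in> \<nu> \<rightarrow>\<^sub>M \<nu>"
  shows "system_coupling \<mu> X \<nu> Y (\<mu> \<Otimes>\<^sub>M \<nu>) T S"
proof -
  interpret MX: compact_metric_prob \<mu> X by fact
  interpret MY: compact_metric_prob \<nu> Y by fact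
  interpret PP: pair_prob_space \<mu> \<nu> by unfold_locales
  have "distr (\<mu> \<Otimes>\<^sub>M \<nu>) \<nu> snd = \<nu>"
  proof (rule measure_eqI)
    fix B assume "B \<in> sets (distr (\<mu> \<Otimes>\<^sub>M \<nu>) \<nu> snd)"
    then have B: "B \<in> sets \<nu>" by simp
    have "snd -` B \<inter> space (\<mu> \<Otimes>\<^sub>M \<nu>) = space \<mu> \<times> B"
      using sets.sets_into_space[OF B] by (auto simp: space_pair_measure)
    then show "emeasure (distr (\<mu> \<Otimes>\<^sub>M \<nu>) \<nu> snd) B = emeasure \<nu> B"
      using B by (simp add: emeasure_distr MY.emeasure_pair_measure_Times MX.emeasure_space_1)
  qed simp
  then show ?thesis
    by (intro system_coupling.intro system_coupling_axioms.intro MX.compact_metric_prob_axioms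
        MY.compact_metric_prob_axioms PP.prob_space_axioms MY.distr_pair_fst T S refl)
qed

section \<open>Ball probabilities and the second moment argument\<close>

context system_coupling
begin

text \<open>With the letters used above for \<open>config\<close>, \<open>near_prob Q R\<close> is
  \<open>a\<close>, \<open>near_prob Q []\<close> is \<open>b\<close> and
  \<open>near_prob [] R\<close> is \<open>c\<close>, as functions of the centres.\<close>

definition near_prob :: "(nat \<times> rat) list \<Rightarrow> (nat \<times> rat) list \<Rightarrow> (nat \<Rightarrow> 'a \<times> 'b) \<Rightarrow> real" where
  "near_prob Q R w = prob {z \<in> space L. near fst Q w z \<and> near snd R w z}"

lemma near_fst_sets: "{x \<in> X. near (\<lambda>x. x) Q w x} \<in> sets \<mu>"
  using MX.open_Int_sets[OF open_near[of Q w]] by (simp add: Int_def conj_commute)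

lemma near_snd_sets: "{y \<in> Y. near (\<lambda>y. y) R w y} \<in> sets \<nu>"
  using MY.open_Int_sets[OF open_near[of R w]] by (simp add: Int_def conj_commute)

lemma near_set_eq: "{z \<in> space L. near fst Q w z \<and> near snd R w z} =
  {x \<in> X. near (\<lambda>x. x) Q (\<lambda>i. fst (w i)) x} \<times> {y \<in> Y. near (\<lambda>y. y) R (\<lambda>i. snd (w i)) y}"
  by (auto simp: space_L near_comp[of fst] near_comp[of snd])

lemma near_sets: "{z \<in> space L. near fst Q w z \<and> near snd R w z} \<in> events"
  unfolding near_set_eq sets_L by (intro pair_measureI near_fst_sets near_snd_sets)

text \<open>The condition is jointly measurable in the centres and the tested point, and the measure
  of a section depends measurably on the centres.\<close>

lemma near_prob_measurable:
  assumes Q: "\<forall>(i, q)\<in>set Q. i < k" and R: "\<forall>(i, q)\<in>set R. i < k"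
  shows "near_prob Q R \<in> borel_measurable (PiM {..<k} (\<lambda>_. L))"
proof -
  let ?P = "PiM {..<k} (\<lambda>_. L)"
  have [measurable]: "Measurable.pred (?P \<Otimes>\<^sub>M L) (\<lambda>x. near fst Q (fst x) (snd x))"
    "Measurable.pred (?P \<Otimes>\<^sub>M L) (\<lambda>x. near snd R (fst x) (snd x))"
    by (rule MX.near_measurable[OF fst_measurable Q] MY.near_measurable[OF snd_measurable R], measurable)+
  have "(\<lambda>w. emeasure L {z \<in> space L. near fst Q w z \<and> near snd R w z}) \<in> borel_measurable ?P"
  proof (rule measurable_emeasure)
    have "{x \<in> space (?P \<Otimes>\<^sub>M L). near fst Q (fst x) (snd x) \<and> near snd R (fst x) (snd x)} \<in> sets (?P \<Otimes>\<^sub>M L)"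
      by measurable
    also have "{x \<in> space (?P \<Otimes>\<^sub>M L). near fst Q (fst x) (snd x) \<and> near snd R (fst x) (snd x)} =
      {x \<in> space (?P \<Otimes>\<^sub>M L). snd x \<in> {z \<in> space L. near fst Q (fst x) z \<and> near snd R (fst x) z}}"
      by (auto simp: space_pair_measure)
    finally show "{x \<in> space (?P \<Otimes>\<^sub>M L). snd x \<in> {z \<in> space L. near fst Q (fst x) z \<and> near snd R (fst x) z}}
      \<in> sets (?P \<Otimes>\<^sub>M L)" .
  qed auto
  then show ?thesis unfolding near_prob_def[abs_def] measure_def by measurable
qed

lemma near_prob_restrict:
  assumes "\<forall>(i, q)\<in>set Q. i < k" and "\<forall>(i, q)\<in>set R. i < k"
  shows "near_prob Q R (restrict w {..<k}) = near_prob Q R w"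
proof -
  have "near fst Q (restrict w {..<k}) z = near fst Q w z" "near snd R (restrict w {..<k}) z = near snd R w z" for z
    using assms by (auto intro!: near_cong)
  then show ?thesis unfolding near_prob_def by simp
qed

text \<open>Replacing each absent condition by the empty list turns all four factors of
  \<open>emeasure_config\<close> into values of \<open>near_prob\<close>.\<close>

lemma emeasure_config_near_prob:
  assumes Q: "\<forall>(i, q)\<in>set Q. i < k" and R: "\<forall>(i, q)\<in>set R. i < k" and pq: "p < 4" "q < 4"
  shows "emeasure (PiM {..<k + 4} (\<lambda>_. L)) (config k Q R p q) =
    (\<integral>\<^sup>+w. ennreal (\<Prod>j<4. near_prob (if j < 2 then Q else []) (if j = p \<or> j = q then R else []) w)
      \<partial>PiM {..<k} (\<lambda>_. L))"
proof -
  have "{z \<in> space L. (j < 2 \<longrightarrow> near fst Q w z) \<and> (j = p \<or> j = q \<longrightarrow> near snd R w z)} =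
    {z \<in> space L. near fst (if j < 2 then Q else []) w z \<and> near snd (if j = p \<or> j = q then R else []) w z}" for j w
    by auto
  then show ?thesis
    unfolding emeasure_config[OF assms] near_prob_def
    by (simp only: emeasure_eq_measure prod_ennreal[OF measure_nonneg])
qed

lemma near_prob_Nil[simp]: "near_prob [] [] w = 1"
  by (simp add: near_prob_def prob_space)

lemma near_prob_nonneg: "0 \<le> near_prob Q R w" and near_prob_le_1: "near_prob Q R w \<le> 1"
  by (simp_all add: near_prob_def)

text \<open>For the product measure \<open>a = b c\<close> holds identically, so the means of
  \<open>a\<^sup>2\<close>, \<open>a b c\<close> and \<open>b\<^sup>2 c\<^sup>2\<close> all equal
  \<open>?V\<close>. Equality of \<open>Phi\<close> carries these three values over to
  \<open>L\<close>, and the mean of \<open>(a - b c)\<^sup>2\<close> becomes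
  \<open>?V - 2 ?V + ?V = 0\<close>.\<close>

lemma AE_near_prob_finite:
  assumes Phi: "Phi T S (k + 4) 1 L = Phi T S (k + 4) 1 (\<mu> \<Otimes>\<^sub>M \<nu>)"
    and Q: "\<forall>(i, q)\<in>set Q. i < k" and R: "\<forall>(i, q)\<in>set R. i < k"
  shows "AE w in PiM {..<k} (\<lambda>_. L). near_prob Q R w = near_prob Q [] w * near_prob [] R w"
proof -
  interpret P: system_coupling \<mu> X \<nu> Y "\<mu> \<Otimes>\<^sub>M \<nu>" T S
    by (rule product_coupling[OF MX.compact_metric_prob_axioms MY.compact_metric_prob_axioms T S])
  let ?L = "PiM {..<k} (\<lambda>_. L)" and ?M = "PiM {..<k} (\<lambda>_. \<mu> \<Otimes>\<^sub>M \<nu>)"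
  let ?a = "near_prob Q R" and ?b = "near_prob Q []" and ?c = "near_prob [] R"
  interpret PL: prob_space ?L by (rule prob_space_PiM) (rule prob_space_axioms)
  have P_mult: "P.near_prob Q R w = P.near_prob Q [] w * P.near_prob [] R w" for w
  proof -
    have *: "P.near_prob Q' R' w = measure \<mu> {x \<in> X. near (\<lambda>x. x) Q' (\<lambda>i. fst (w i)) x} *
      measure \<nu> {y \<in> Y. near (\<lambda>y. y) R' (\<lambda>i. snd (w i)) y}" for Q' R'
      unfolding P.near_prob_def P.near_set_eq using near_fst_sets near_snd_sets
      by (simp add: measure_def MY.emeasure_pair_measure_Times enn2real_mult)
    show ?thesis unfolding * by (simp add: MX.prob_space[unfolded MX.space_eq] MY.prob_space[unfolded MY.space_eq])
  qed
  have four: "(\<Prod>j<4. f j) = f 0 * f 1 * f 2 * f (3::nat)" for f :: "nat \<Rightarrow> real"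
    by (simp add: eval_nat_numeral)
  have V: "(\<integral>\<^sup>+w. ennreal (\<Prod>j<4. near_prob (if j < 2 then Q else []) (if j = p \<or> j = q then R else []) w) \<partial>?L) =
    (\<integral>\<^sup>+w. ennreal (\<Prod>j<4. P.near_prob (if j < 2 then Q else []) (if j = p \<or> j = q then R else []) w) \<partial>?M)"
    if pq: "p < 4" "q < 4" for p q :: nat
    using emeasure_config_near_prob[OF Q R pq] P.emeasure_config_near_prob[OF Q R pq]
      emeasure_config_Phi[OF Q R pq] P.emeasure_config_Phi[OF Q R pq] Phi by simp
  let ?V = "\<integral>\<^sup>+w. ennreal ((P.near_prob Q [] w)\<^sup>2 * (P.near_prob [] R w)\<^sup>2) \<partial>?M"
  \<comment> \<open>The four factors are \<open>a, a, 1, 1\<close> for the pattern (0, 1), then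
    \<open>a, b, c, 1\<close> for (0, 2), and \<open>b, b, c, c\<close> for (2, 3).\<close>
  have "(\<integral>\<^sup>+w. ennreal ((?a w)\<^sup>2) \<partial>?L) = ?V"
    using V[of 0 1] by (simp add: four P_mult power2_eq_square mult_ac)
  moreover have "(\<integral>\<^sup>+w. ennreal (?a w * ?b w * ?c w) \<partial>?L) = ?V"
    using V[of 0 2] by (simp add: four P_mult power2_eq_square mult_ac)
  moreover have "(\<integral>\<^sup>+w. ennreal ((?b w)\<^sup>2 * (?c w)\<^sup>2) \<partial>?L) = ?V"
    using V[of 2 3] by (simp add: four power2_eq_square mult_ac)
  moreover have m[measurable]: "?a \<in> borel_measurable ?L" "?b \<in> borel_measurable ?L" "?c \<in> borel_measurable ?L"
    using Q R by (auto intro: near_prob_measurable)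
  \<comment> \<open>Boundedness by 1 allows the passage to real integrals, in which the square can
    be expanded with its negative middle term.\<close>
  have i1: "integrable ?L (\<lambda>w. (?a w)\<^sup>2)"
    by (rule PL.integrable_const_bound[of _ 1]) (auto simp: near_prob_nonneg near_prob_le_1 intro!: power_le_one)
  have i2: "integrable ?L (\<lambda>w. ?a w * ?b w * ?c w)"
    by (rule PL.integrable_const_bound[of _ 1]) (auto simp: near_prob_nonneg near_prob_le_1 abs_mult intro!: mult_le_one)
  have i3: "integrable ?L (\<lambda>w. (?b w)\<^sup>2 * (?c w)\<^sup>2)"
    by (rule PL.integrable_const_bound[of _ 1]) (auto simp: near_prob_nonneg near_prob_le_1 abs_mult intro!: mult_le_one power_le_one)
  have "(\<integral>\<^sup>+w. ennreal ((?a w)\<^sup>2) \<partial>?L) = ennreal (\<integral>w. (?a w)\<^sup>2 \<partial>?L)"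
    "(\<integral>\<^sup>+w. ennreal (?a w * ?b w * ?c w) \<partial>?L) = ennreal (\<integral>w. ?a w * ?b w * ?c w \<partial>?L)"
    "(\<integral>\<^sup>+w. ennreal ((?b w)\<^sup>2 * (?c w)\<^sup>2) \<partial>?L) = ennreal (\<integral>w. (?b w)\<^sup>2 * (?c w)\<^sup>2 \<partial>?L)"
    by (intro nn_integral_eq_integral i1 i2 i3 AE_I2 mult_nonneg_nonneg near_prob_nonneg zero_le_power2)+
  ultimately have "ennreal (\<integral>w. (?a w)\<^sup>2 \<partial>?L) = ennreal (\<integral>w. ?a w * ?b w * ?c w \<partial>?L)"
    "ennreal (\<integral>w. (?b w)\<^sup>2 * (?c w)\<^sup>2 \<partial>?L) = ennreal (\<integral>w. ?a w * ?b w * ?c w \<partial>?L)" by simp_all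
  then have eq: "(\<integral>w. (?a w)\<^sup>2 \<partial>?L) = (\<integral>w. ?a w * ?b w * ?c w \<partial>?L)"
    "(\<integral>w. (?b w)\<^sup>2 * (?c w)\<^sup>2 \<partial>?L) = (\<integral>w. ?a w * ?b w * ?c w \<partial>?L)"
    by (subst (asm) ennreal_inj; simp add: near_prob_nonneg integral_nonneg_AE)+
  have sq: "(?a w - ?b w * ?c w)\<^sup>2 = (?a w)\<^sup>2 - 2 * (?a w * ?b w * ?c w) + (?b w)\<^sup>2 * (?c w)\<^sup>2" for w
    by (simp add: power2_diff power_mult_distrib)
  have i: "integrable ?L (\<lambda>w. (?a w - ?b w * ?c w)\<^sup>2)"
    unfolding sq by (intro Bochner_Integration.integrable_add Bochner_Integration.integrable_diff
      integrable_mult_right i1 i2 i3)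
  have "(\<integral>w. (?a w - ?b w * ?c w)\<^sup>2 \<partial>?L) = 0"
    unfolding sq using i1 i2 i3 eq by simp
  then have "AE w in ?L. (?a w - ?b w * ?c w)\<^sup>2 = 0"
    using integral_nonneg_eq_0_iff_AE[OF i] by simp
  then show ?thesis by eventually_elim simp
qed

text \<open>Each pair of lists uses finitely many centres, and the first \<open>k\<close>
  coordinates of the infinite sample are distributed as a sample of size \<open>k\<close>. Since
  pairs of lists are countably many, the exceptional null sets can be united.\<close>

lemma AE_near_prob:
  assumes Phi: "\<And>k. Phi T S (k + 4) 1 L = Phi T S (k + 4) 1 (\<mu> \<Otimes>\<^sub>M \<nu>)"
  shows "AE w in PiM UNIV (\<lambda>_::nat. L). \<forall>Q R. near_prob Q R w = near_prob Q [] w * near_prob [] R w"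
  unfolding AE_all_countable
proof (intro allI)
  fix Q R :: "(nat \<times> rat) list"
  interpret P: product_prob_space "\<lambda>_::nat. L" UNIV by unfold_locales
  obtain k where "\<forall>i\<in>fst ` (set Q \<union> set R). i < k"
    using finite_nat_set_iff_bounded[of "fst ` (set Q \<union> set R)"] by auto
  then have k: "\<forall>(i, q)\<in>set Q. i < k" "\<forall>(i, q)\<in>set R. i < k" by force+
  let ?r = "\<lambda>w. restrict w {..<k}"
  have "?r \<in> PiM UNIV (\<lambda>_. L) \<rightarrow>\<^sub>M PiM {..<k} (\<lambda>_. L)"
    by (intro measurable_restrict_subset) auto
  moreover have "AE w in distr (PiM UNIV (\<lambda>_. L)) (PiM {..<k} (\<lambda>_. L)) ?r.
      near_prob Q R w = near_prob Q [] w * near_prob [] R w"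
    unfolding P.distr_PiM_restrict_finite[OF finite_lessThan subset_UNIV] by (rule AE_near_prob_finite[OF Phi k])
  ultimately have "AE w in PiM UNIV (\<lambda>_. L). near_prob Q R (?r w) = near_prob Q [] (?r w) * near_prob [] R (?r w)"
    by (rule AE_distrD)
  then show "AE w in PiM UNIV (\<lambda>_. L). near_prob Q R w = near_prob Q [] w * near_prob [] R w"
    using k by (simp add: near_prob_restrict)
qed

text \<open>For a typical sample \<open>w\<close>, the sets coded by lists on the \<open>X\<close>
  side are independent of those on the \<open>Y\<close> side, and they generate all cylinders over
  measurable sets up to null sets. Hence the two coordinates are independent under
  \<open>L\<close>.\<close>

lemma Phi_eq_imp_product:
  assumes Phi: "\<And>k. Phi T S (k + 4) 1 L = Phi T S (k + 4) 1 (\<mu> \<Otimes>\<^sub>M \<nu>)"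
  shows "L = \<mu> \<Otimes>\<^sub>M \<nu>"
proof -
  interpret PP: prob_space "PiM UNIV (\<lambda>_::nat. L)" by (rule prob_space_PiM) (rule prob_space_axioms)
  have "AE w in PiM UNIV (\<lambda>_::nat. L).
    (\<forall>Q R. near_prob Q R w = near_prob Q [] w * near_prob [] R w) \<and>
    (\<forall>U p. open U \<longrightarrow> p \<in> U \<longrightarrow> p \<in> MX.support \<longrightarrow> (\<exists>i. fst (w i) \<in> U)) \<and>
    (\<forall>U p. open U \<longrightarrow> p \<in> U \<longrightarrow> p \<in> MY.support \<longrightarrow> (\<exists>i. snd (w i) \<in> U))"
    by (intro AE_conjI AE_near_prob[OF Phi]
      MX.AE_samples_dense_in_support[OF prob_space_axioms fst_measurable distr_fst]
      MY.AE_samples_dense_in_support[OF prob_space_axioms snd_measurable distr_snd])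
  \<comment> \<open>An almost sure event of a probability space is nonempty, so one sample with all
    three properties can be fixed.\<close>
  from eventually_happens[OF this] PP.ae_filter_bot obtain w where
    w: "\<forall>Q R. near_prob Q R w = near_prob Q [] w * near_prob [] R w"
      "\<forall>U p. open U \<longrightarrow> p \<in> U \<longrightarrow> p \<in> MX.support \<longrightarrow> (\<exists>i. fst (w i) \<in> U)"
      "\<forall>U p. open U \<longrightarrow> p \<in> U \<longrightarrow> p \<in> MY.support \<longrightarrow> (\<exists>i. snd (w i) \<in> U)"
    unfolding trivial_limit_def by blast
  note ind = w(1)[rule_format] and dX = w(2)[rule_format] and dY = w(3)[rule_format]
  let ?EX = "range (\<lambda>R. {z \<in> space L. near fst R w z})"
  let ?EY = "range (\<lambda>R. {z \<in> space L. near snd R w z})"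
  \<comment> \<open>The factorization of \<open>near_prob\<close> says that the two generators are
    independent; both are stable under intersection, by concatenation of lists, so independence
    passes to the generated sigma-algebras.\<close>
  have indep: "indep_set (sigma_sets (space L) ?EX) (sigma_sets (space L) ?EY)"
  proof (rule indep_set_sigma_sets)
    show "indep_set ?EX ?EY"
    proof (rule indep_setI)
      show "?EX \<subseteq> events" using near_sets[of _ w "[]"] by auto
      show "?EY \<subseteq> events" using near_sets[of "[]" w] by auto
      fix a b assume "a \<in> ?EX" "b \<in> ?EY"
      then obtain Q R where ab: "a = {z \<in> space L. near fst Q w z}" "b = {z \<in> space L. near snd R w z}" by auto
      then have "a \<inter> b = {z \<in> space L. near fst Q w z \<and> near snd R w z}" by auto
      then show "prob (a \<inter> b) = prob a * prob b" using ind[of Q R] by (simp add: near_prob_def ab)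
    qed
    have stable: "Int_stable (range (\<lambda>R. {z \<in> space L. near f R w z}))" for f :: "'a \<times> 'b \<Rightarrow> 'c::metric_space"
    proof (rule Int_stableI)
      fix a b assume "a \<in> range (\<lambda>R. {z \<in> space L. near f R w z})" "b \<in> range (\<lambda>R. {z \<in> space L. near f R w z})"
      then obtain Q R where "a = {z \<in> space L. near f Q w z}" "b = {z \<in> space L. near f R w z}" by auto
      then have "a \<inter> b = {z \<in> space L. near f (Q @ R) w z}" by (auto simp: near_append)
      then show "a \<inter> b \<in> range (\<lambda>R. {z \<in> space L. near f R w z})" by auto
    qed
    show "Int_stable ?EX" "Int_stable ?EY" by (rule stable)+
  qed
  have AX: "AE z in L. fst z \<in> MX.support"
    by (rule AE_distrD[OF fst_measurable, unfolded distr_fst, OF MX.AE_support])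
  have AY: "AE z in L. snd z \<in> MY.support"
    by (rule AE_distrD[OF snd_measurable, unfolded distr_snd, OF MY.AE_support])
  have "\<mu> \<Otimes>\<^sub>M \<nu> = L"
  proof (rule pair_measure_eqI)
    show "sigma_finite_measure \<mu>" "sigma_finite_measure \<nu>" by unfold_locales
    show "sets (\<mu> \<Otimes>\<^sub>M \<nu>) = sets L" by (simp add: sets_L)
    fix A B assume A: "A \<in> sets \<mu>" and B: "B \<in> sets \<nu>"
    have fX: "fst \<in> space L \<rightarrow> X" and sY: "snd \<in> space L \<rightarrow> Y" by (auto simp: space_L)
    have gX: "\<exists>D\<in>sigma_sets (space L) ?EX. \<forall>z\<in>space L. fst z \<in> MX.support \<longrightarrow> (z \<in> D \<longleftrightarrow> fst z \<in> A)"
      unfolding near_def by (rule MX.sets_generated_by_balls[OF fX _ A]) (rule dX)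
    obtain D where D: "D \<in> sigma_sets (space L) ?EX" "\<forall>z\<in>space L. fst z \<in> MX.support \<longrightarrow> (z \<in> D \<longleftrightarrow> fst z \<in> A)"
      using gX by blast
    have gY: "\<exists>D\<in>sigma_sets (space L) ?EY. \<forall>z\<in>space L. snd z \<in> MY.support \<longrightarrow> (z \<in> D \<longleftrightarrow> snd z \<in> B)"
      unfolding near_def by (rule MY.sets_generated_by_balls[OF sY _ B]) (rule dY)
    obtain D' where D': "D' \<in> sigma_sets (space L) ?EY" "\<forall>z\<in>space L. snd z \<in> MY.support \<longrightarrow> (z \<in> D' \<longleftrightarrow> snd z \<in> B)"
      using gY by blast
    have ev: "D \<in> events" "D' \<in> events" using indep_setD_ev1[OF indep] indep_setD_ev2[OF indep] D D' by auto
    have AxB: "A \<times> B \<in> events" "A \<times> Y \<in> events" "X \<times> B \<in> events"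
      using A B sets.top[of \<mu>] sets.top[of \<nu>] by (auto simp: sets_L MX.space_eq MY.space_eq)
    \<comment> \<open>Differences can occur only where a coordinate leaves its support, and the
      marginals make this a null set.\<close>
    have "AE z in L. (z \<in> A \<times> Y \<longleftrightarrow> z \<in> D) \<and> (z \<in> X \<times> B \<longleftrightarrow> z \<in> D') \<and> (z \<in> A \<times> B \<longleftrightarrow> z \<in> D \<inter> D')"
      using AX AY AE_space by eventually_elim (use D(2) D'(2) in \<open>auto simp: space_L\<close>)
    then have "prob (A \<times> Y) = prob D" "prob (X \<times> B) = prob D'" "prob (A \<times> B) = prob (D \<inter> D')"
      using AxB ev by (intro finite_measure_eq_AE; auto elim: eventually_mono)+
    then have "prob (A \<times> B) = measure \<mu> A * measure \<nu> B"
      using indep_setD[OF indep D(1) D'(1)] Times_distr_fst[OF A] Times_distr_snd[OF B] by simp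
    then show "emeasure \<mu> A * emeasure \<nu> B = emeasure L (A \<times> B)"
      by (simp add: emeasure_eq_measure MX.emeasure_eq_measure MY.emeasure_eq_measure ennreal_mult)
  qed
  then show ?thesis ..
qed

end

section \<open>Twin-free quotients\<close>

lemma twin_class_self: "z \<in> space P \<Longrightarrow> z \<in> twin_class P Mk K z"
  by (simp add: twin_class_def twins_def)

lemma space_tw_space: "space (tw_space P Mk K) = twin_class P Mk K ` space P"
  by (simp add: tw_space_def space_measure_of_conv)

lemma sets_tw_space:
  "sets (tw_space P Mk K) = sigma_sets (twin_class P Mk K ` space P)
     {A. A \<subseteq> twin_class P Mk K ` space P \<and> twin_class P Mk K -` A \<inter> space P \<in> sets P}"
  unfolding tw_space_def sets_distr by (rule sets_measure_of) auto

lemma twin_class_measurable: "twin_class P Mk K \<in> P \<rightarrow>\<^sub>M tw_space P Mk K"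
  unfolding tw_space_def measurable_distr_eq2 by (rule measurable_measure_of) auto

lemma distr_twin_class: "distr P (tw_space P Mk K) (twin_class P Mk K) = tw_space P Mk K"
  by (subst (2) tw_space_def, rule distr_cong) (auto simp: tw_space_def)

lemma prob_space_tw_space: "prob_space P \<Longrightarrow> prob_space (tw_space P Mk K)"
  by (subst distr_twin_class[symmetric], rule prob_space.prob_space_distr[OF _ twin_class_measurable])

text \<open>The quotient carries the final sigma-algebra: every set of classes with measurable
  preimage is measurable.\<close>

lemma measurable_tw_space:
  assumes f: "(\<lambda>z. f (twin_class P Mk K z)) \<in> P \<rightarrow>\<^sub>M N"
  shows "f \<in> tw_space P Mk K \<rightarrow>\<^sub>M N"
proof (rule measurableI)
  show "f C \<in> space N" if "C \<in> space (tw_space P Mk K)" for C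
    using that measurable_space[OF f] by (auto simp: space_tw_space)
  fix A assume A: "A \<in> sets N"
  have "twin_class P Mk K -` (f -` A \<inter> space (tw_space P Mk K)) \<inter> space P =
    (\<lambda>z. f (twin_class P Mk K z)) -` A \<inter> space P"
    by (auto simp: space_tw_space)
  also have "\<dots> \<in> sets P" by (rule measurable_sets[OF f A])
  finally show "f -` A \<inter> space (tw_space P Mk K) \<in> sets (tw_space P Mk K)"
    unfolding sets_tw_space by (intro sigma_sets.Basic) (auto simp: space_tw_space)
qed

text \<open>Whichever representative is chosen, it is a twin of \<open>z\<close>, and twins agree in
  every mark.\<close>

lemma tw_mark_twin_class:
  assumes "z \<in> space P"
  shows "tw_mark P Mk K c (twin_class P Mk K z) = Mk c z"
proof -
  have "(SOME z'. z' \<in> twin_class P Mk K z) \<in> twin_class P Mk K z"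
    by (rule someI[where P="\<lambda>z'. z' \<in> twin_class P Mk K z", OF twin_class_self[OF assms]])
  then have "twins P Mk K z (SOME z'. z' \<in> twin_class P Mk K z)"
    unfolding twin_class_def[of P Mk K z] by (blast dest: CollectD)
  then show ?thesis unfolding tw_mark_def twins_def by metis
qed

section \<open>Matrix laws under measure-preserving maps\<close>

lemma distr_pair_same:
  assumes f: "f \<in> P \<rightarrow>\<^sub>M Q" and d: "distr P Q f = Q" and Q: "prob_space Q"
  shows "distr (P \<Otimes>\<^sub>M P) (Q \<Otimes>\<^sub>M Q) (\<lambda>p. (f (fst p), f (snd p))) = Q \<Otimes>\<^sub>M Q"
proof -
  have "sigma_finite_measure (distr P Q f)"
    unfolding d using Q by (simp add: prob_space_imp_sigma_finite)
  from pair_measure_distr[OF f f this] show ?thesis by (simp add: d case_prod_beta')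
qed

text \<open>This turns statements holding almost everywhere on the square into almost sure
  statements about two different sample points. For \<open>i = j\<close> the law would sit on the
  diagonal, which may be a null set of the square.\<close>

lemma distr_PiM_pair:
  assumes P: "prob_space P" and ij: "i \<in> I" "j \<in> I" "i \<noteq> j"
  shows "distr (PiM I (\<lambda>_. P)) (P \<Otimes>\<^sub>M P) (\<lambda>z. (z i, z j)) = P \<Otimes>\<^sub>M P"
proof -
  interpret P: prob_space P by fact
  interpret PP: product_prob_space "\<lambda>_. P" I by unfold_locales
  have m: "(\<lambda>z. (z i, z j)) \<in> PiM I (\<lambda>_. P) \<rightarrow>\<^sub>M P \<Otimes>\<^sub>M P"
    by (intro measurable_Pair measurable_component_singleton ij)
  have "P \<Otimes>\<^sub>M P = distr (PiM I (\<lambda>_. P)) (P \<Otimes>\<^sub>M P) (\<lambda>z. (z i, z j))"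
  proof (rule pair_measure_eqI)
    fix A B assume A: "A \<in> sets P" and B: "B \<in> sets P"
    have "emeasure (distr (PiM I (\<lambda>_. P)) (P \<Otimes>\<^sub>M P) (\<lambda>z. (z i, z j))) (A \<times> B) =
      emeasure (PiM I (\<lambda>_. P)) {z \<in> space (PiM I (\<lambda>_. P)). \<forall>l\<in>{i, j}. z l \<in> (if l = i then A else B)}"
      using A B ij m by (subst emeasure_distr) (auto intro!: arg_cong2[where f=emeasure])
    also have "\<dots> = (\<Prod>l\<in>{i, j}. emeasure P (if l = i then A else B))"
      by (rule PP.emeasure_PiM_Collect) (use A B ij in auto)
    finally show "emeasure P A * emeasure P B = emeasure (distr (PiM I (\<lambda>_. P)) (P \<Otimes>\<^sub>M P) (\<lambda>z. (z i, z j))) (A \<times> B)"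
      using ij by simp
  qed (auto intro: P.sigma_finite_measure_axioms)
  then show ?thesis ..
qed

text \<open>Entries comparing a sample point with itself are taken from the marks: kernels are known
  only up to null sets of the square and carry no information on the diagonal.\<close>

definition mat_of :: "(bool \<times> nat \<times> nat \<Rightarrow> 'z \<Rightarrow> real) \<Rightarrow> (bool \<times> nat \<times> nat \<Rightarrow> 'z \<Rightarrow> 'z \<Rightarrow> real) \<Rightarrow> nat \<Rightarrow> nat
    \<Rightarrow> bool \<Rightarrow> (nat \<Rightarrow> 'z) \<Rightarrow> (nat \<times> nat) \<times> (nat \<times> nat) \<Rightarrow> real" where
  "mat_of Mk K n m s z = restrict (\<lambda>((i, a), (j, b)). if i = j then Mk (s, a, b) (z i) else K (s, a, b) (z i) (z j))
     (mat_idx n m)"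

text \<open>The case \<open>i = j\<close> agrees because \<open>jkernel\<close> at two equal
  arguments is \<open>jmark\<close>.\<close>

lemma DX_mat_of: "DX T n m = mat_of (jmark T S) (jkernel T S) n m True"
  by (auto simp: DX_def mat_of_def jmark_def jkernel_def fun_eq_iff restrict_def split: prod.splits)

lemma DY_mat_of: "DY S n m = mat_of (jmark T S) (jkernel T S) n m False"
  by (auto simp: DY_def mat_of_def jmark_def jkernel_def fun_eq_iff restrict_def split: prod.splits)

lemma mat_of_measurable:
  assumes Mk: "\<And>c. Mk c \<in> borel_measurable Q"
    and K: "\<And>c. (\<lambda>p. K c (fst p) (snd p)) \<in> borel_measurable (Q \<Otimes>\<^sub>M Q)"
  shows "mat_of Mk K n m s \<in> PiM {..<n} (\<lambda>_. Q) \<rightarrow>\<^sub>M mat_space n m"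
  unfolding mat_of_def[abs_def] mat_space_def
proof (rule measurable_restrict)
  fix x assume "x \<in> mat_idx n m"
  then obtain i a j b where x: "x = ((i, a), (j, b))" and ij: "i \<in> {..<n}" "j \<in> {..<n}"
    by (auto simp: mat_idx_def)
  have "(\<lambda>z. K (s, a, b) (z i) (z j)) \<in> borel_measurable (PiM {..<n} (\<lambda>_. Q))"
    using measurable_compose[OF measurable_Pair[OF measurable_component_singleton[OF ij(1)]
        measurable_component_singleton[OF ij(2)]] K[of "(s, a, b)"]] by simp
  moreover have "(\<lambda>z. Mk (s, a, b) (z i)) \<in> borel_measurable (PiM {..<n} (\<lambda>_. Q))"
    by (rule measurable_compose[OF measurable_component_singleton[OF ij(1)] Mk])
  ultimately show "(\<lambda>z. (\<lambda>((i, a), (j, b)). if i = j then Mk (s, a, b) (z i) else K (s, a, b) (z i) (z j)) x)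
    \<in> borel_measurable (PiM {..<n} (\<lambda>_. Q))" by (simp add: x)
qed

context system_coupling
begin

lemma jmark_measurable: "jmark T S c \<in> borel_measurable L"
proof (cases c)
  case (fields s a b)
  have "(\<lambda>z. dist ((T ^^ a) (fst z)) ((T ^^ b) (fst z))) \<in> borel_measurable L"
    "(\<lambda>z. dist ((S ^^ a) (snd z)) ((S ^^ b) (snd z))) \<in> borel_measurable L"
    by (intro MX.measurable_dist MY.measurable_dist measurable_compose[OF _ T_pow] measurable_compose[OF _ S_pow]
        fst_measurable snd_measurable)+
  then show ?thesis by (cases s) (simp_all add: fields jmark_def case_prod_beta')
qed

lemma jkernel_measurable: "(\<lambda>p. jkernel T S c (fst p) (snd p)) \<in> borel_measurable (L \<Otimes>\<^sub>M L)"
proof (cases c)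
  case (fields s a b)
  have "(\<lambda>p. dist ((T ^^ a) (fst (fst p))) ((T ^^ b) (fst (snd p)))) \<in> borel_measurable (L \<Otimes>\<^sub>M L)"
    "(\<lambda>p. dist ((S ^^ a) (snd (fst p))) ((S ^^ b) (snd (snd p)))) \<in> borel_measurable (L \<Otimes>\<^sub>M L)"
    by (intro MX.measurable_dist MY.measurable_dist measurable_compose[OF _ T_pow] measurable_compose[OF _ S_pow]
        measurable_compose[OF _ fst_measurable] measurable_compose[OF _ snd_measurable] measurable_fst measurable_snd)+
  then show ?thesis by (cases s) (simp_all add: fields jkernel_def case_prod_beta')
qed

text \<open>A measure-preserving map \<open>W\<close> takes i.i.d. samples to i.i.d. samples. If it
  carries marks and kernels almost everywhere, the matrices computed before and after
  \<open>W\<close> agree almost surely, since they involve finitely many sample points and countably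
  many marks and kernels.\<close>

lemma Phi_eq_distr_factor:
  assumes Q: "prob_space Q" and W: "W \<in> completion L \<rightarrow>\<^sub>M Q" and d: "distr (completion L) Q W = Q"
    and Mk: "\<And>c. Mk c \<in> borel_measurable Q"
    and K: "\<And>c. (\<lambda>p. K c (fst p) (snd p)) \<in> borel_measurable (Q \<Otimes>\<^sub>M Q)"
    and AE_Mk: "\<And>c. AE z in completion L. Mk c (W z) = jmark T S c z"
    and AE_K: "\<And>c. AE p in completion L \<Otimes>\<^sub>M completion L. K c (W (fst p)) (W (snd p)) = jkernel T S c (fst p) (snd p)"
  shows "Phi T S n m L = distr (PiM {..<n} (\<lambda>_. Q)) (mat_space n m \<Otimes>\<^sub>M mat_space n m)
    (\<lambda>z. (mat_of Mk K n m True z, mat_of Mk K n m False z))"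
proof -
  let ?P = "completion L" and ?I = "{..<n}" and ?MM = "mat_space n m \<Otimes>\<^sub>M mat_space n m"
  interpret P: prob_space ?P by (rule prob_space_completion)
  let ?F = "\<lambda>z. (DX T n m z, DY S n m z)"
  let ?G = "\<lambda>z. (mat_of Mk K n m True z, mat_of Mk K n m False z)"
  \<comment> \<open>\<open>W\<close> is measurable only on the completion, so the common sample is
    drawn there; the identity turns it into a sample of \<open>L\<close>.\<close>
  have idm: "(\<lambda>z. z) \<in> ?P \<rightarrow>\<^sub>M L" by (rule measurable_completion) simp
  have idd: "distr ?P L (\<lambda>z. z) = L" using distr_completion[of "\<lambda>z. z" L L] by (simp add: distr_id)
  have D: "distr (PiM ?I (\<lambda>_. ?P)) (PiM ?I (\<lambda>_. N)) (compose ?I f) = PiM ?I (\<lambda>_. N)"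
    if "prob_space N" "f \<in> ?P \<rightarrow>\<^sub>M N" "distr ?P N f = N" for N :: "'e measure" and f
    using distr_PiM_finite_prob_space'[of ?I "\<lambda>_. ?P" "\<lambda>_. N" f] that P.prob_space_axioms by simp
  have cm: "compose ?I f \<in> PiM ?I (\<lambda>_. ?P) \<rightarrow>\<^sub>M PiM ?I (\<lambda>_. N)" if f: "f \<in> ?P \<rightarrow>\<^sub>M N" for N :: "'e measure" and f
    unfolding compose_def by (intro measurable_restrict measurable_compose[OF _ f] measurable_component_singleton)
  have Fm: "?F \<in> PiM ?I (\<lambda>_. L) \<rightarrow>\<^sub>M ?MM" by measurable
  have Gm: "?G \<in> PiM ?I (\<lambda>_. Q) \<rightarrow>\<^sub>M ?MM"
    by (intro measurable_Pair mat_of_measurable Mk K)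
  have "AE z in PiM ?I (\<lambda>_. ?P). \<forall>i\<in>?I. \<forall>c. Mk c (W (z i)) = jmark T S c (z i)"
    unfolding AE_ball_countable[OF countable_finite[OF finite_lessThan]] AE_all_countable
    by (intro ballI allI AE_PiM_component[where P="\<lambda>z. Mk _ (W z) = jmark T S _ z"] AE_Mk P.prob_space_axioms)
  moreover have "AE z in PiM ?I (\<lambda>_. ?P). \<forall>i\<in>?I. \<forall>j\<in>?I. i \<noteq> j \<longrightarrow>
      (\<forall>c. K c (W (z i)) (W (z j)) = jkernel T S c (z i) (z j))"
    unfolding AE_ball_countable[OF countable_finite[OF finite_lessThan]]
  proof (intro ballI AE_impI)
    fix i j assume ij: "i \<in> ?I" "j \<in> ?I" "i \<noteq> j"
    have "AE p in ?P \<Otimes>\<^sub>M ?P. \<forall>c. K c (W (fst p)) (W (snd p)) = jkernel T S c (fst p) (snd p)"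
      unfolding AE_all_countable using AE_K by simp
    then have "AE p in distr (PiM ?I (\<lambda>_. ?P)) (?P \<Otimes>\<^sub>M ?P) (\<lambda>z. (z i, z j)).
        \<forall>c. K c (W (fst p)) (W (snd p)) = jkernel T S c (fst p) (snd p)"
      unfolding distr_PiM_pair[OF P.prob_space_axioms ij] .
    then have "AE z in PiM ?I (\<lambda>_. ?P). \<forall>c. K c (W (fst (z i, z j))) (W (snd (z i, z j))) =
        jkernel T S c (fst (z i, z j)) (snd (z i, z j))"
      by (rule AE_distrD[rotated]) (intro measurable_Pair measurable_component_singleton ij)
    then show "AE z in PiM ?I (\<lambda>_. ?P). \<forall>c. K c (W (z i)) (W (z j)) = jkernel T S c (z i) (z j)" by simp
  qed
  ultimately have ae: "AE z in PiM ?I (\<lambda>_. ?P). ?F (compose ?I (\<lambda>z. z) z) = ?G (compose ?I W z)"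
  proof eventually_elim
    case (elim z)
    have "mat_of (jmark T S) (jkernel T S) n m s (compose ?I (\<lambda>z. z) z) = mat_of Mk K n m s (compose ?I W z)" for s
      unfolding mat_of_def using elim by (intro restrict_ext) (auto simp: mat_idx_def compose_def)
    then show ?case unfolding DX_mat_of[where S=S] DY_mat_of[where T=T] by simp
  qed
  have "Phi T S n m L = distr (distr (PiM ?I (\<lambda>_. ?P)) (PiM ?I (\<lambda>_. L)) (compose ?I (\<lambda>z. z))) ?MM ?F"
    unfolding Phi_def D[OF prob_space_axioms idm idd] ..
  also have "\<dots> = distr (PiM ?I (\<lambda>_. ?P)) ?MM (?F \<circ> compose ?I (\<lambda>z. z))"
    by (rule distr_distr[OF Fm cm[OF idm]])
  also have "\<dots> = distr (PiM ?I (\<lambda>_. ?P)) ?MM (?G \<circ> compose ?I W)"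
    by (rule distr_cong_AE) (use ae measurable_comp[OF cm[OF idm] Fm] measurable_comp[OF cm[OF W] Gm] in \<open>simp_all add: comp_def\<close>)
  also have "\<dots> = distr (distr (PiM ?I (\<lambda>_. ?P)) (PiM ?I (\<lambda>_. Q)) (compose ?I W)) ?MM ?G"
    by (rule distr_distr[OF Gm cm[OF W], symmetric])
  also have "\<dots> = distr (PiM ?I (\<lambda>_. Q)) ?MM ?G"
    unfolding D[OF Q W d] ..
  finally show ?thesis .
qed

lemma tw_mark_measurable:
  "tw_mark (completion L) (jmark T S) K c \<in> borel_measurable (tw_space (completion L) (jmark T S) K)"
  by (rule measurable_tw_space,
      rule measurable_cong[THEN iffD2, OF _ measurable_completion[OF jmark_measurable[of c]]])
     (rule tw_mark_twin_class)

section \<open>Existence of descended kernels\<close>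

text \<open>The kernels at time (0, 0) are the two metrics. If a coordinate of \<open>z\<close>
  differs from that of \<open>z'\<close>, points near the former are strictly closer to it than to
  the latter, and they have positive probability because \<open>z\<close> lies over the
  supports.\<close>

lemma twins_in_support_eq:
  assumes "twins (completion L) (jmark T S) (jkernel T S) z z'"
    and z: "fst z \<in> MX.support" "snd z \<in> MY.support" and z': "fst z' \<in> MX.support" "snd z' \<in> MY.support"
  shows "z = z'"
proof (rule prod_eqI)
  have ae: "AE w in L. jkernel T S c z w = jkernel T S c z' w" for c
    using assms(1) unfolding twins_def AE_completion_iff by blast
  show "fst z = fst z'"
  proof (rule ccontr)
    assume ne: "fst z \<noteq> fst z'"
    \<comment> \<open>With this radius, a point of \<open>U\<close> at equal distance from
      \<open>fst z\<close> and \<open>fst z'\<close> would contradict the triangle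
      inequality.\<close>
    define U where "U = ball (fst z) (dist (fst z) (fst z') / 2)"
    have UX: "U \<inter> X \<in> sets \<mu>" by (rule MX.open_Int_sets) (simp add: U_def)
    have "AE w in L. w \<notin> (U \<inter> X) \<times> Y" using ae[of "(True, 0, 0)"]
    proof eventually_elim
      case (elim w)
      then have "dist (fst z) (fst w) = dist (fst z') (fst w)" by (simp add: jkernel_def case_prod_beta')
      then show ?case using dist_triangle2[of "fst z" "fst z'" "fst w"] by (auto simp: U_def)
    qed
    moreover have "(U \<inter> X) \<times> Y \<in> events"
      using UX sets.top[of \<nu>] by (simp add: sets_L MY.space_eq)
    ultimately have "measure \<mu> (U \<inter> X) = 0" by (metis prob_eq_0 Times_distr_fst[OF UX])
    moreover have "measure \<mu> (U \<inter> X) > 0" using z(1) ne unfolding MX.support_def U_def by auto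
    ultimately show False by simp
  qed
  show "snd z = snd z'"
  proof (rule ccontr)
    assume ne: "snd z \<noteq> snd z'"
    define U where "U = ball (snd z) (dist (snd z) (snd z') / 2)"
    have UY: "U \<inter> Y \<in> sets \<nu>" by (rule MY.open_Int_sets) (simp add: U_def)
    have "AE w in L. w \<notin> X \<times> (U \<inter> Y)" using ae[of "(False, 0, 0)"]
    proof eventually_elim
      case (elim w)
      then have "dist (snd z) (snd w) = dist (snd z') (snd w)" by (simp add: jkernel_def case_prod_beta')
      then show ?case using dist_triangle2[of "snd z" "snd z'" "snd w"] by (auto simp: U_def)
    qed
    moreover have "X \<times> (U \<inter> Y) \<in> events"
      using UY sets.top[of \<mu>] by (simp add: sets_L MX.space_eq)
    ultimately have "measure \<nu> (U \<inter> Y) = 0" by (metis prob_eq_0 Times_distr_snd[OF UY])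
    moreover have "measure \<nu> (U \<inter> Y) > 0" using z(2) ne unfolding MY.support_def U_def by auto
    ultimately show False by simp
  qed
qed

text \<open>Each twin class contains at most one point of the product of the supports; picking it gives an a.e. inverse of
  the quotient map, measurable only with respect to the completion.\<close>
lemma descended_kernel_exists:
  "\<exists>K'. \<forall>c. descended_kernel (completion L) (jmark T S) (jkernel T S) c (K' c)"
proof -
  let ?P = "completion L"
  let ?q = "twin_class ?P (jmark T S) (jkernel T S)" and ?Q = "tw_space ?P (jmark T S) (jkernel T S)"
  interpret P: prob_space ?P by (rule prob_space_completion)
  define G where "G = MX.support \<times> MY.support"
  obtain z0 where z0: "z0 \<in> space L" using not_empty by auto
  \<comment> \<open>The default \<open>z0\<close> keeps \<open>s\<close> inside the space on classes
    that miss \<open>G\<close>; on the others the choice is unique by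
    \<open>twins_in_support_eq\<close>.\<close>
  define s where "s C = (if C \<inter> G = {} then z0 else (SOME z. z \<in> C \<inter> G))" for C
  have GX: "G \<subseteq> space L" unfolding G_def space_L using MX.support_subset MY.support_subset by auto
  have Gs: "G \<in> sets L" unfolding G_def sets_L by (intro pair_measureI MX.support_sets MY.support_sets)
  have GAE: "AE z in L. z \<in> G"
    using AE_distrD[OF fst_measurable, unfolded distr_fst, OF MX.AE_support]
      AE_distrD[OF snd_measurable, unfolded distr_snd, OF MY.AE_support]
    by eventually_elim (simp add: G_def mem_Times_iff)
  have sG: "s (?q z) = z" if z: "z \<in> G" for z
  proof -
    have zq: "z \<in> ?q z \<inter> G" using twin_class_self[of z ?P] z GX by auto
    then have "(SOME z'. z' \<in> ?q z \<inter> G) \<in> ?q z \<inter> G" by (rule someI[of "\<lambda>z'. z' \<in> ?q z \<inter> G"])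
    then have "z = (SOME z'. z' \<in> ?q z \<inter> G)"
      using z by (intro twins_in_support_eq) (auto simp: twin_class_def G_def mem_Times_iff)
    then show ?thesis using zq unfolding s_def by auto
  qed
  have s_space: "s C \<in> space L" for C
  proof (cases "C \<inter> G = {}")
    case False
    then have "(SOME z. z \<in> C \<inter> G) \<in> C \<inter> G" by (intro someI_ex[of "\<lambda>z. z \<in> C \<inter> G"]) auto
    then show ?thesis using False GX by (auto simp: s_def)
  qed (simp add: s_def z0)
  have null: "space L - G \<in> null_sets L"
  proof -
    have "AE z in L. z \<notin> space L - G" using GAE by eventually_elim simp
    then show ?thesis using AE_iff_null_sets[of "space L - G" L] Gs by blast
  qed
  \<comment> \<open>The composite is the identity on \<open>G\<close>, so a preimage of
    \<open>A\<close> is \<open>A \<inter> G\<close> together with a subset of the null set outside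
    \<open>G\<close>; completeness makes it measurable.\<close>
  have "(\<lambda>z. s (?q z)) \<in> ?P \<rightarrow>\<^sub>M L"
  proof (rule measurableI)
    fix A assume A: "A \<in> sets L"
    let ?V = "(\<lambda>z. s (?q z)) -` A \<inter> space ?P"
    show "?V \<in> sets ?P"
    proof (rule sets_completionI)
      show "?V = (A \<inter> G) \<union> (?V - G)" using sG GX by auto
      show "?V - G \<subseteq> space L - G" by auto
    qed (use A Gs null in auto)
  qed (simp add: s_space)
  then have sm: "s \<in> ?Q \<rightarrow>\<^sub>M L" by (rule measurable_tw_space)
  \<comment> \<open>Evaluating the original kernel at the representatives gives a jointly measurable
    function, exact on \<open>G \<times> G\<close>.\<close>
  have "descended_kernel ?P (jmark T S) (jkernel T S) c (\<lambda>C D. jkernel T S c (s C) (s D))" for c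
    unfolding descended_kernel_def
  proof
    show "(\<lambda>(C, D). jkernel T S c (s C) (s D)) \<in> borel_measurable (?Q \<Otimes>\<^sub>M ?Q)"
      using measurable_compose[OF measurable_Pair[OF measurable_compose[OF measurable_fst sm]
            measurable_compose[OF measurable_snd sm]] jkernel_measurable[of c]]
      by (simp add: case_prod_beta')
    have "AE p in ?P \<Otimes>\<^sub>M ?P. fst p \<in> G \<and> snd p \<in> G"
    proof (rule AE_conjI)
      interpret PP: pair_prob_space ?P ?P by unfold_locales
      show "AE p in ?P \<Otimes>\<^sub>M ?P. fst p \<in> G"
      proof (rule AE_distrD[OF measurable_fst])
        show "AE z in distr (?P \<Otimes>\<^sub>M ?P) ?P fst. z \<in> G"
          unfolding P.distr_pair_fst by (rule AE_completion[OF GAE])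
      qed
      have "snd -` G \<inter> space (?P \<Otimes>\<^sub>M ?P) \<in> sets (?P \<Otimes>\<^sub>M ?P)"
        by (rule measurable_sets[OF measurable_snd sets_completionI_sets[OF Gs]])
      then have "{p \<in> space (?P \<Otimes>\<^sub>M ?P). snd p \<in> G} \<in> sets (?P \<Otimes>\<^sub>M ?P)"
        by (simp add: vimage_def Int_def conj_commute)
      then have "AE p in ?P \<Otimes>\<^sub>M ?P. (\<lambda>x y. y \<in> G) (fst p) (snd p)"
        using AE_completion[OF GAE] by (intro PP.AE_pair_measure) simp_all
      then show "AE p in ?P \<Otimes>\<^sub>M ?P. snd p \<in> G" by simp
    qed
    then show "AE p in ?P \<Otimes>\<^sub>M ?P. jkernel T S c (s (?q (fst p))) (s (?q (snd p))) = jkernel T S c (fst p) (snd p)"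
      by eventually_elim (simp add: sG)
  qed
  then show ?thesis by (intro exI allI)
qed

text \<open>The identity is the isomorphism, with the same descended kernels on both sides; the
  content is that such kernels exist.\<close>

lemma joining_equiv_refl: "joining_equiv T S L L"
proof -
  let ?Q = "tw_space (completion L) (jmark T S) (jkernel T S)"
  obtain K' where K': "\<forall>c. descended_kernel (completion L) (jmark T S) (jkernel T S) c (K' c)"
    using descended_kernel_exists by blast
  have "kernel_iso ?Q M1 K' ?Q M1 K'" for M1 :: "bool \<times> nat \<times> nat \<Rightarrow> _"
    unfolding kernel_iso_def by (intro exI[of _ "\<lambda>x. x"]) (simp add: distr_id)
  with K' show ?thesis unfolding joining_equiv_def tw_kernel_iso_def by blast
qed

end

text \<open>Both sides are the law of the matrices sampled from the quotient of \<open>L'\<close>: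
  for \<open>L\<close> through its class map followed by the isomorphism \<open>U\<close>, for
  \<open>L'\<close> through its own class map.\<close>

lemma joining_equiv_imp_Phi_eq:
  assumes L: "system_coupling \<mu> X \<nu> Y L T S" and L': "system_coupling \<mu> X \<nu> Y L' T S"
    and eq: "joining_equiv T S L L'"
  shows "Phi T S n m L = Phi T S n m L'"
proof -
  interpret L: system_coupling \<mu> X \<nu> Y L T S by fact
  interpret L': system_coupling \<mu> X \<nu> Y L' T S by fact
  let ?P = "completion L" and ?P' = "completion L'"
  let ?q = "twin_class ?P (jmark T S) (jkernel T S)" and ?Q = "tw_space ?P (jmark T S) (jkernel T S)"
  let ?q' = "twin_class ?P' (jmark T S) (jkernel T S)" and ?Q' = "tw_space ?P' (jmark T S) (jkernel T S)"
  let ?M = "tw_mark ?P (jmark T S) (jkernel T S)" and ?M' = "tw_mark ?P' (jmark T S) (jkernel T S)"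
  have pQ: "prob_space ?Q" and pQ': "prob_space ?Q'"
    by (intro prob_space_tw_space L.prob_space_completion L'.prob_space_completion)+
  obtain K K' U where K: "\<And>c. descended_kernel ?P (jmark T S) (jkernel T S) c (K c)"
    and K': "\<And>c. descended_kernel ?P' (jmark T S) (jkernel T S) c (K' c)"
    and U: "U \<in> ?Q \<rightarrow>\<^sub>M ?Q'" "distr ?Q ?Q' U = ?Q'"
    and UM: "\<And>c. AE x in ?Q. ?M' c (U x) = ?M c x"
    and UK: "\<And>c. AE p in ?Q \<Otimes>\<^sub>M ?Q. K' c (U (fst p)) (U (snd p)) = K c (fst p) (snd p)"
    using eq unfolding joining_equiv_def tw_kernel_iso_def kernel_iso_def by blast
  have q: "?q \<in> ?P \<rightarrow>\<^sub>M ?Q" "distr ?P ?Q ?q = ?Q" by (rule twin_class_measurable distr_twin_class)+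
  have q': "?q' \<in> ?P' \<rightarrow>\<^sub>M ?Q'" "distr ?P' ?Q' ?q' = ?Q'" by (rule twin_class_measurable distr_twin_class)+
  have K'm: "(\<lambda>p. K' c (fst p) (snd p)) \<in> borel_measurable (?Q' \<Otimes>\<^sub>M ?Q')" for c
    using K'[of c] unfolding descended_kernel_def by (simp add: case_prod_beta')
  have "Phi T S n m L = distr (PiM {..<n} (\<lambda>_. ?Q')) (mat_space n m \<Otimes>\<^sub>M mat_space n m)
    (\<lambda>z. (mat_of ?M' K' n m True z, mat_of ?M' K' n m False z))"
  proof (rule L.Phi_eq_distr_factor[OF pQ', where W="\<lambda>z. U (?q z)"])
    show "(\<lambda>z. U (?q z)) \<in> ?P \<rightarrow>\<^sub>M ?Q'" by (rule measurable_compose[OF q(1) U(1)])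
    show "distr ?P ?Q' (\<lambda>z. U (?q z)) = ?Q'"
      using distr_distr[OF U(1) q(1)] by (simp add: q(2) U(2) comp_def)
    show "?M' c \<in> borel_measurable ?Q'" for c by (rule L'.tw_mark_measurable)
    show "(\<lambda>p. K' c (fst p) (snd p)) \<in> borel_measurable (?Q' \<Otimes>\<^sub>M ?Q')" for c by (rule K'm)
    show "AE z in ?P. ?M' c (U (?q z)) = jmark T S c z" for c
    proof -
      have "AE z in ?P. ?M' c (U (?q z)) = ?M c (?q z)"
        by (rule AE_distrD[OF q(1), unfolded q(2), OF UM])
      then show ?thesis using AE_space by eventually_elim (simp add: tw_mark_twin_class)
    qed
    show "AE p in ?P \<Otimes>\<^sub>M ?P. K' c (U (?q (fst p))) (U (?q (snd p))) = jkernel T S c (fst p) (snd p)" for c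
    proof -
      have m: "(\<lambda>p. (?q (fst p), ?q (snd p))) \<in> ?P \<Otimes>\<^sub>M ?P \<rightarrow>\<^sub>M ?Q \<Otimes>\<^sub>M ?Q"
        by (intro measurable_Pair measurable_compose[OF _ q(1)] measurable_fst measurable_snd)
      have "AE p in ?P \<Otimes>\<^sub>M ?P. K' c (U (?q (fst p))) (U (?q (snd p))) = K c (?q (fst p)) (?q (snd p))"
        using AE_distrD[OF m, unfolded distr_pair_same[OF q pQ], OF UK[of c]] by simp
      moreover have "AE p in ?P \<Otimes>\<^sub>M ?P. K c (?q (fst p)) (?q (snd p)) = jkernel T S c (fst p) (snd p)"
        using K[of c] unfolding descended_kernel_def by simp
      ultimately show ?thesis by eventually_elim simp
    qed
  qed
  also have "\<dots> = Phi T S n m L'"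
  proof (rule L'.Phi_eq_distr_factor[OF pQ' q', symmetric])
    show "?M' c \<in> borel_measurable ?Q'" for c by (rule L'.tw_mark_measurable)
    show "(\<lambda>p. K' c (fst p) (snd p)) \<in> borel_measurable (?Q' \<Otimes>\<^sub>M ?Q')" for c by (rule K'm)
    show "AE z in ?P'. ?M' c (?q' z) = jmark T S c z" for c
      using AE_space by eventually_elim (simp add: tw_mark_twin_class)
    show "AE p in ?P' \<Otimes>\<^sub>M ?P'. K' c (?q' (fst p)) (?q' (snd p)) = jkernel T S c (fst p) (snd p)" for c
      using K'[of c] unfolding descended_kernel_def by simp
  qed
  finally show ?thesis .
qed

section \<open>Joinings\<close>

lemma cmmps_compact_metric_prob: "cmmps X \<mu> T \<Longrightarrow> compact_metric_prob \<mu> X"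
  unfolding cmmps_def compact_metric_prob_def compact_metric_prob_axioms_def by simp

lemma sets_restrict_borel_cmmps:
  assumes "cmmps X \<mu> T" and "cmmps Y \<nu> S"
  shows "sets (restrict_space borel (X \<times> Y)) = sets (\<mu> \<Otimes>\<^sub>M \<nu>)"
proof -
  have "sets (\<mu> \<Otimes>\<^sub>M \<nu>) = sets (restrict_space borel X \<Otimes>\<^sub>M restrict_space borel Y)"
    using assms by (intro sets_pair_measure_cong) (auto simp: cmmps_def)
  then show ?thesis using assms sets_restrict_borel_Times[of X Y] by (simp add: cmmps_def)
qed

lemma joinings_imp_coupling:
  assumes "cmmps X \<mu> T" and "cmmps Y \<nu> S" and "L \<in> joinings X \<mu> T Y \<nu> S"
  shows "system_coupling \<mu> X \<nu> Y L T S"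
  using assms cmmps_compact_metric_prob[OF assms(1)] cmmps_compact_metric_prob[OF assms(2)]
    sets_restrict_borel_cmmps[OF assms(1,2)]
  unfolding system_coupling_def system_coupling_axioms_def joinings_def cmmps_def by simp

text \<open>That the product is a joining makes the set of joinings nonempty, so a constant
  \<open>Phi\<close> has a singleton image rather than an empty one.\<close>

lemma product_in_joinings:
  assumes X: "cmmps X \<mu> T" and Y: "cmmps Y \<nu> S"
  shows "\<mu> \<Otimes>\<^sub>M \<nu> \<in> joinings X \<mu> T Y \<nu> S" and "system_coupling \<mu> X \<nu> Y (\<mu> \<Otimes>\<^sub>M \<nu>) T S"
proof -
  have T: "T \<in> \<mu> \<rightarrow>\<^sub>M \<mu>" "distr \<mu> \<mu> T = \<mu>" "space \<mu> = X" and S: "S \<in> \<nu> \<rightarrow>\<^sub>M \<nu>" "distr \<nu> \<nu> S = \<nu>" "space \<nu> = Y"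
    using X Y by (auto simp: cmmps_def)
  interpret MX: compact_metric_prob \<mu> X by (rule cmmps_compact_metric_prob[OF X])
  interpret MY: compact_metric_prob \<nu> Y by (rule cmmps_compact_metric_prob[OF Y])
  interpret PP: pair_prob_space \<mu> \<nu> by unfold_locales
  show C: "system_coupling \<mu> X \<nu> Y (\<mu> \<Otimes>\<^sub>M \<nu>) T S"
    by (intro product_coupling MX.compact_metric_prob_axioms MY.compact_metric_prob_axioms T S)
  interpret C: system_coupling \<mu> X \<nu> Y "\<mu> \<Otimes>\<^sub>M \<nu>" T S by fact
  have "(\<lambda>(x, y). (T x, S y)) \<in> \<mu> \<Otimes>\<^sub>M \<nu> \<rightarrow>\<^sub>M \<mu> \<Otimes>\<^sub>M \<nu>"
    using T(1) S(1) by measurable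
  moreover have "distr (\<mu> \<Otimes>\<^sub>M \<nu>) (\<mu> \<Otimes>\<^sub>M \<nu>) (\<lambda>(x, y). (T x, S y)) = \<mu> \<Otimes>\<^sub>M \<nu>"
    using pair_measure_distr[OF T(1) S(1)] MY.sigma_finite_measure_axioms by (simp add: T S)
  ultimately show "\<mu> \<Otimes>\<^sub>M \<nu> \<in> joinings X \<mu> T Y \<nu> S"
    unfolding joinings_def
    using PP.prob_space_axioms C.space_L C.distr_fst C.distr_snd sets_restrict_borel_cmmps[OF X Y] by simp
qed

theorem theorem15:
  fixes X :: "'a::metric_space set" and \<mu> :: "'a measure" and T :: "'a \<Rightarrow> 'a"
    and Y :: "'b::metric_space set" and \<nu> :: "'b measure" and S :: "'b \<Rightarrow> 'b"
  assumes "cmmps X \<mu> T" and "cmmps Y \<nu> S"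
  shows "(\<forall>L\<in>joinings X \<mu> T Y \<nu> S. joining_equiv T S L (\<mu> \<Otimes>\<^sub>M \<nu>))
     \<longleftrightarrow> (\<forall>n m. n \<ge> 1 \<longrightarrow> m \<ge> 1 \<longrightarrow>
           Phi T S n m ` joinings X \<mu> T Y \<nu> S = {Phi T S n m (\<mu> \<Otimes>\<^sub>M \<nu>)})"
proof -
  note P = product_in_joinings[OF assms]
  note coupling = joinings_imp_coupling[OF assms]
  have "joining_equiv T S L (\<mu> \<Otimes>\<^sub>M \<nu>)"
    if Phi: "\<forall>n m. n \<ge> 1 \<longrightarrow> m \<ge> 1 \<longrightarrow> Phi T S n m ` joinings X \<mu> T Y \<nu> S = {Phi T S n m (\<mu> \<Otimes>\<^sub>M \<nu>)}"
      and L: "L \<in> joinings X \<mu> T Y \<nu> S" for L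
  proof -
    \<comment> \<open>The sample consists of \<open>k\<close> centres and four tested points, at the
      single time 0.\<close>
    have "Phi T S (k + 4) 1 L = Phi T S (k + 4) 1 (\<mu> \<Otimes>\<^sub>M \<nu>)" for k
      using Phi[rule_format, of "k + 4" 1] L by auto
    then have "L = \<mu> \<Otimes>\<^sub>M \<nu>" by (rule system_coupling.Phi_eq_imp_product[OF coupling[OF L]])
    then show ?thesis using system_coupling.joining_equiv_refl[OF P(2)] by simp
  qed
  moreover have "Phi T S n m ` joinings X \<mu> T Y \<nu> S = {Phi T S n m (\<mu> \<Otimes>\<^sub>M \<nu>)}"
    if eq: "\<forall>L\<in>joinings X \<mu> T Y \<nu> S. joining_equiv T S L (\<mu> \<Otimes>\<^sub>M \<nu>)" for n m
  proof -
    have "Phi T S n m ` joinings X \<mu> T Y \<nu> S = (\<lambda>_. Phi T S n m (\<mu> \<Otimes>\<^sub>M \<nu>)) ` joinings X \<mu> T Y \<nu> S"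
      by (rule image_cong[OF refl joining_equiv_imp_Phi_eq[OF coupling P(2) eq[rule_format]]])
    also have "\<dots> = {Phi T S n m (\<mu> \<Otimes>\<^sub>M \<nu>)}" by (rule image_constant[OF P(1)])
    finally show ?thesis .
  qed
  ultimately show ?thesis by blast
qed

end
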